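(* There exist compact locally conformally Kähler manifolds (of complex dimension $n\ge 2$) whose Lee vector field is holomorphic and which are not Vaisman.
   Context: Let $(M,J,g)$ be a Hermitian manifold of complex dimension $n\ge 2$ ($J$ an integrable complex structure, $g$ a $J$-Hermitian Riemannian metric), with fundamental form $\omega(\cdot,\cdot)=g(J\cdot,\cdot)$. It is called locally conformally Kähler (lcK) if there exists a closed $1$-form $\theta$ (the Lee form) such that $d\omega=\theta\wedge\omega$. The Lee vector field is the metric dual $\theta^\sharp$, defined by $g(\theta^\sharp,\cdot)=\theta$. If moreover $\theta$ is parallel with respect to the Levi-Civita connection of $g$, the manifold (and the metric) is called Vaisman. A (real) vector field $X$ is called holomorphic if $\mathcal{L}_XJ=0$. *)

theory Defs
  imports "HOL-Analysis.Analysis"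
begin

text \<open>
  Manifolds of real dimension \<open>N\<close> are modelled on the topology \<^const>\<open>Euclidean_space\<close> \<open>N\<close>,
  whose points are the sequences vanishing from index \<open>N\<close> on; the dimension is thus a term
  and can be quantified. Coordinates are numbered \<open>0, \<dots>, N - 1\<close>.
\<close>

section \<open>Smooth functions on open subsets of Euclidean space\<close>

definition pderiv_at :: "nat \<Rightarrow> ((nat \<Rightarrow> real) \<Rightarrow> real) \<Rightarrow> (nat \<Rightarrow> real) \<Rightarrow> real"
  where "pderiv_at i f x = deriv (\<lambda>t. f (x(i := t))) (x i)"

definition iter_pderiv :: "nat list \<Rightarrow> ((nat \<Rightarrow> real) \<Rightarrow> real) \<Rightarrow> (nat \<Rightarrow> real) \<Rightarrow> real"
  where "iter_pderiv is f = foldr pderiv_at is f"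

text \<open>
  For \<open>S\<close> open in \<open>Euclidean_space N\<close>, smoothness means that the partial derivatives of all
  orders exist and are continuous. The values of \<open>f\<close> outside \<open>S\<close> play no role.
\<close>

definition smooth_fun_on :: "nat \<Rightarrow> (nat \<Rightarrow> real) set \<Rightarrow> ((nat \<Rightarrow> real) \<Rightarrow> real) \<Rightarrow> bool"
  where "smooth_fun_on N S f \<longleftrightarrow>
    (\<forall>is. set is \<subseteq> {..<N} \<longrightarrow>
      continuous_map (subtopology (Euclidean_space N) S) euclideanreal (iter_pderiv is f) \<and>
      (\<forall>x\<in>S. \<forall>i<N. (\<lambda>t. iter_pderiv is f (x(i := t))) differentiable at (x i)))"


section \<open>Smooth manifolds\<close>

type_synonym 'a chart = "'a set \<times> ('a \<Rightarrow> nat \<Rightarrow> real)"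

definition coord_range :: "'a chart \<Rightarrow> (nat \<Rightarrow> real) set"
  where "coord_range c = snd c ` fst c"

definition overlap :: "'a chart \<Rightarrow> 'a chart \<Rightarrow> (nat \<Rightarrow> real) set"
  where "overlap c d = snd c ` (fst c \<inter> fst d)"

definition transition :: "'a chart \<Rightarrow> 'a chart \<Rightarrow> (nat \<Rightarrow> real) \<Rightarrow> nat \<Rightarrow> real"
  where "transition c d x = snd d (inv_into (fst c) (snd c) x)"

definition jacobian :: "'a chart \<Rightarrow> 'a chart \<Rightarrow> (nat \<Rightarrow> real) \<Rightarrow> nat \<Rightarrow> nat \<Rightarrow> real"
  where "jacobian c d x i j = pderiv_at j (\<lambda>y. transition c d y i) x"

definition is_chart :: "'a topology \<Rightarrow> nat \<Rightarrow> 'a chart \<Rightarrow> bool"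
  where "is_chart X N c \<longleftrightarrow>
    openin X (fst c) \<and> openin (Euclidean_space N) (coord_range c) \<and>
    homeomorphic_map (subtopology X (fst c)) (subtopology (Euclidean_space N) (coord_range c)) (snd c)"

definition compatible :: "nat \<Rightarrow> 'a chart \<Rightarrow> 'a chart \<Rightarrow> bool"
  where "compatible N c d \<longleftrightarrow>
    (\<forall>i<N. smooth_fun_on N (overlap c d) (\<lambda>x. transition c d x i)) \<and>
    (\<forall>i<N. smooth_fun_on N (overlap d c) (\<lambda>x. transition d c x i))"

text \<open>The atlas need not be maximal: it determines the smooth structure.\<close>

definition smooth_manifold :: "'a topology \<Rightarrow> nat \<Rightarrow> 'a chart set \<Rightarrow> bool"
  where "smooth_manifold X N A \<longleftrightarrow>
    Hausdorff_space X \<and> second_countable X \<and>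
    (\<forall>c\<in>A. is_chart X N c) \<and> topspace X = (\<Union>c\<in>A. fst c) \<and>
    (\<forall>c\<in>A. \<forall>d\<in>A. compatible N c d)"


section \<open>Tensor fields\<close>

text \<open>
  A tensor field is given by its components in every chart of the atlas, as functions of the
  coordinates, subject to the usual transformation law. For an endomorphism field \<open>J\<close> the
  component \<open>J c x i j\<close> has upper index \<open>i\<close> and lower index \<open>j\<close>, i.e.
  \<open>J \<partial>\<^sub>j = \<Sum>i. J c x i j \<partial>\<^sub>i\<close>.
\<close>

type_synonym 'a tensor1 = "'a chart \<Rightarrow> (nat \<Rightarrow> real) \<Rightarrow> nat \<Rightarrow> real"
type_synonym 'a tensor2 = "'a chart \<Rightarrow> (nat \<Rightarrow> real) \<Rightarrow> nat \<Rightarrow> nat \<Rightarrow> real"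

definition one_form :: "nat \<Rightarrow> 'a chart set \<Rightarrow> 'a tensor1 \<Rightarrow> bool"
  where "one_form N A \<alpha> \<longleftrightarrow>
    (\<forall>c\<in>A. \<forall>i<N. smooth_fun_on N (coord_range c) (\<lambda>x. \<alpha> c x i)) \<and>
    (\<forall>c\<in>A. \<forall>d\<in>A. \<forall>x\<in>overlap c d. \<forall>i<N.
      \<alpha> c x i = (\<Sum>k<N. \<alpha> d (transition c d x) k * jacobian c d x k i))"

definition bilinear_field :: "nat \<Rightarrow> 'a chart set \<Rightarrow> 'a tensor2 \<Rightarrow> bool"
  where "bilinear_field N A b \<longleftrightarrow>
    (\<forall>c\<in>A. \<forall>i<N. \<forall>j<N. smooth_fun_on N (coord_range c) (\<lambda>x. b c x i j)) \<and>
    (\<forall>c\<in>A. \<forall>d\<in>A. \<forall>x\<in>overlap c d. \<forall>i<N. \<forall>j<N.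
      b c x i j = (\<Sum>k<N. \<Sum>l<N. b d (transition c d x) k l * jacobian c d x k i * jacobian c d x l j))"

definition endo_field :: "nat \<Rightarrow> 'a chart set \<Rightarrow> 'a tensor2 \<Rightarrow> bool"
  where "endo_field N A J \<longleftrightarrow>
    (\<forall>c\<in>A. \<forall>i<N. \<forall>j<N. smooth_fun_on N (coord_range c) (\<lambda>x. J c x i j)) \<and>
    (\<forall>c\<in>A. \<forall>d\<in>A. \<forall>x\<in>overlap c d. \<forall>i<N. \<forall>j<N.
      (\<Sum>k<N. jacobian c d x i k * J c x k j) = (\<Sum>k<N. J d (transition c d x) i k * jacobian c d x k j))"


section \<open>Hermitian manifolds\<close>

definition riemannian_metric :: "nat \<Rightarrow> 'a chart set \<Rightarrow> 'a tensor2 \<Rightarrow> bool"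
  where "riemannian_metric N A g \<longleftrightarrow> bilinear_field N A g \<and>
    (\<forall>c\<in>A. \<forall>x\<in>coord_range c.
      (\<forall>i<N. \<forall>j<N. g c x i j = g c x j i) \<and>
      (\<forall>v. (\<exists>i<N. v i \<noteq> 0) \<longrightarrow> (\<Sum>i<N. \<Sum>j<N. g c x i j * v i * v j) > 0))"

definition almost_complex :: "nat \<Rightarrow> 'a chart set \<Rightarrow> 'a tensor2 \<Rightarrow> bool"
  where "almost_complex N A J \<longleftrightarrow> endo_field N A J \<and>
    (\<forall>c\<in>A. \<forall>x\<in>coord_range c. \<forall>i<N. \<forall>j<N.
      (\<Sum>k<N. J c x i k * J c x k j) = (if i = j then - 1 else 0))"

text \<open>
  Multiplication by the imaginary unit in the real coordinates of complex \<open>n\<close>-space ordered as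
  \<open>Re z\<^sub>0, Im z\<^sub>0, Re z\<^sub>1, Im z\<^sub>1, \<dots>\<close>.
\<close>

definition std_complex :: "nat \<Rightarrow> nat \<Rightarrow> real"
  where "std_complex i j =
    (if even j \<and> i = Suc j then 1 else if even i \<and> j = Suc i then - 1 else 0)"

text \<open>
  Integrability: around every point there is a chart of the smooth structure (not necessarily
  one of \<open>A\<close>) in which \<open>J\<close> is the standard complex structure. Two such charts are related by a
  holomorphic map, so that they form a holomorphic atlas inducing \<open>J\<close>.
\<close>

definition integrable_complex :: "'a topology \<Rightarrow> nat \<Rightarrow> 'a chart set \<Rightarrow> 'a tensor2 \<Rightarrow> bool"
  where "integrable_complex X N A J \<longleftrightarrow>
    (\<forall>p\<in>topspace X. \<exists>d. is_chart X N d \<and> p \<in> fst d \<and> (\<forall>c\<in>A. compatible N c d) \<and>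
      (\<forall>c\<in>A. \<forall>x\<in>overlap c d. \<forall>i<N. \<forall>j<N.
        (\<Sum>k<N. jacobian c d x i k * J c x k j) = (\<Sum>k<N. std_complex i k * jacobian c d x k j)))"

definition hermitian_manifold ::
    "'a topology \<Rightarrow> nat \<Rightarrow> 'a chart set \<Rightarrow> 'a tensor2 \<Rightarrow> 'a tensor2 \<Rightarrow> bool"
  where "hermitian_manifold X n A J g \<longleftrightarrow>
    smooth_manifold X (2 * n) A \<and>
    almost_complex (2 * n) A J \<and> integrable_complex X (2 * n) A J \<and>
    riemannian_metric (2 * n) A g \<and>
    (\<forall>c\<in>A. \<forall>x\<in>coord_range c. \<forall>i<2 * n. \<forall>j<2 * n.
      (\<Sum>k<2 * n. \<Sum>l<2 * n. g c x k l * J c x k i * J c x l j) = g c x i j)"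

text \<open>\<open>\<omega>(\<partial>\<^sub>i, \<partial>\<^sub>j) = g(J \<partial>\<^sub>i, \<partial>\<^sub>j)\<close>.\<close>

definition fundamental_form :: "nat \<Rightarrow> 'a tensor2 \<Rightarrow> 'a tensor2 \<Rightarrow> 'a tensor2"
  where "fundamental_form N J g c x i j = (\<Sum>k<N. J c x k i * g c x k j)"


section \<open>Locally conformally Kaehler and Vaisman manifolds\<close>

definition ext_deriv1 :: "'a tensor1 \<Rightarrow> 'a tensor2"
  where "ext_deriv1 \<alpha> c x i j =
    pderiv_at i (\<lambda>y. \<alpha> c y j) x - pderiv_at j (\<lambda>y. \<alpha> c y i) x"

definition ext_deriv2 :: "'a tensor2 \<Rightarrow> 'a chart \<Rightarrow> (nat \<Rightarrow> real) \<Rightarrow> nat \<Rightarrow> nat \<Rightarrow> nat \<Rightarrow> real"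
  where "ext_deriv2 \<beta> c x i j k =
    pderiv_at i (\<lambda>y. \<beta> c y j k) x - pderiv_at j (\<lambda>y. \<beta> c y i k) x + pderiv_at k (\<lambda>y. \<beta> c y i j) x"

definition wedge12 ::
    "'a tensor1 \<Rightarrow> 'a tensor2 \<Rightarrow> 'a chart \<Rightarrow> (nat \<Rightarrow> real) \<Rightarrow> nat \<Rightarrow> nat \<Rightarrow> nat \<Rightarrow> real"
  where "wedge12 \<alpha> \<beta> c x i j k =
    \<alpha> c x i * \<beta> c x j k - \<alpha> c x j * \<beta> c x i k + \<alpha> c x k * \<beta> c x i j"

definition closed_form :: "nat \<Rightarrow> 'a chart set \<Rightarrow> 'a tensor1 \<Rightarrow> bool"
  where "closed_form N A \<alpha> \<longleftrightarrow>
    (\<forall>c\<in>A. \<forall>x\<in>coord_range c. \<forall>i<N. \<forall>j<N. ext_deriv1 \<alpha> c x i j = 0)"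

definition lee_form :: "nat \<Rightarrow> 'a chart set \<Rightarrow> 'a tensor2 \<Rightarrow> 'a tensor2 \<Rightarrow> 'a tensor1 \<Rightarrow> bool"
  where "lee_form n A J g \<theta> \<longleftrightarrow>
    one_form (2 * n) A \<theta> \<and> closed_form (2 * n) A \<theta> \<and>
    (\<forall>c\<in>A. \<forall>x\<in>coord_range c. \<forall>i<2 * n. \<forall>j<2 * n. \<forall>k<2 * n.
      ext_deriv2 (fundamental_form (2 * n) J g) c x i j k =
      wedge12 \<theta> (fundamental_form (2 * n) J g) c x i j k)"

definition lck_manifold ::
    "'a topology \<Rightarrow> nat \<Rightarrow> 'a chart set \<Rightarrow> 'a tensor2 \<Rightarrow> 'a tensor2 \<Rightarrow> bool"
  where "lck_manifold X n A J g \<longleftrightarrow>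
    hermitian_manifold X n A J g \<and> (\<exists>\<theta>. lee_form n A J g \<theta>)"

text \<open>
  The vector \<open>v\<close> with \<open>b(v, \<cdot>) = \<alpha>\<close>; it exists and is unique when \<open>b\<close> is positive definite.
  The condition on the indices from \<open>N\<close> on makes it unique as a sequence.
\<close>

definition raise_index :: "nat \<Rightarrow> (nat \<Rightarrow> nat \<Rightarrow> real) \<Rightarrow> (nat \<Rightarrow> real) \<Rightarrow> nat \<Rightarrow> real"
  where "raise_index N b \<alpha> =
    (THE v. (\<forall>i\<ge>N. v i = 0) \<and> (\<forall>j<N. (\<Sum>i<N. b i j * v i) = \<alpha> j))"

definition metric_dual :: "nat \<Rightarrow> 'a tensor2 \<Rightarrow> 'a tensor1 \<Rightarrow> 'a tensor1"
  where "metric_dual N g \<alpha> c x = raise_index N (g c x) (\<alpha> c x)"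

text \<open>
  \<open>christoffel N g c x i j\<close> is the sequence of components of \<open>\<nabla>\<^sub>i \<partial>\<^sub>j\<close> for the Levi-Civita
  connection of \<open>g\<close>, given by the Koszul formula for \<open>g(\<nabla>\<^sub>i \<partial>\<^sub>j, \<partial>\<^sub>l)\<close>.
\<close>

definition christoffel ::
    "nat \<Rightarrow> 'a tensor2 \<Rightarrow> 'a chart \<Rightarrow> (nat \<Rightarrow> real) \<Rightarrow> nat \<Rightarrow> nat \<Rightarrow> nat \<Rightarrow> real"
  where "christoffel N g c x i j =
    raise_index N (g c x)
      (\<lambda>l. (pderiv_at i (\<lambda>y. g c y j l) x + pderiv_at j (\<lambda>y. g c y i l) x
             - pderiv_at l (\<lambda>y. g c y i j) x) / 2)"

text \<open>\<open>(\<nabla>\<^sub>i \<alpha>)(\<partial>\<^sub>j)\<close>.\<close>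

definition cov_deriv :: "nat \<Rightarrow> 'a tensor2 \<Rightarrow> 'a tensor1 \<Rightarrow> 'a tensor2"
  where "cov_deriv N g \<alpha> c x i j =
    pderiv_at i (\<lambda>y. \<alpha> c y j) x - (\<Sum>k<N. christoffel N g c x i j k * \<alpha> c x k)"

definition parallel_form :: "nat \<Rightarrow> 'a chart set \<Rightarrow> 'a tensor2 \<Rightarrow> 'a tensor1 \<Rightarrow> bool"
  where "parallel_form N A g \<alpha> \<longleftrightarrow>
    (\<forall>c\<in>A. \<forall>x\<in>coord_range c. \<forall>i<N. \<forall>j<N. cov_deriv N g \<alpha> c x i j = 0)"

definition vaisman_manifold ::
    "'a topology \<Rightarrow> nat \<Rightarrow> 'a chart set \<Rightarrow> 'a tensor2 \<Rightarrow> 'a tensor2 \<Rightarrow> bool"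
  where "vaisman_manifold X n A J g \<longleftrightarrow>
    hermitian_manifold X n A J g \<and> (\<exists>\<theta>. lee_form n A J g \<theta> \<and> parallel_form (2 * n) A g \<theta>)"

text \<open>
  \<open>(L\<^sub>V J) \<partial>\<^sub>j = [V, J \<partial>\<^sub>j] - J [V, \<partial>\<^sub>j]\<close>, component \<open>i\<close>.
\<close>

definition lie_deriv_endo :: "nat \<Rightarrow> 'a tensor1 \<Rightarrow> 'a tensor2 \<Rightarrow> 'a tensor2"
  where "lie_deriv_endo N V J c x i j =
    (\<Sum>k<N. V c x k * pderiv_at k (\<lambda>y. J c y i j) x
           - J c x k j * pderiv_at k (\<lambda>y. V c y i) x
           + J c x i k * pderiv_at j (\<lambda>y. V c y k) x)"

definition holomorphic_field :: "nat \<Rightarrow> 'a chart set \<Rightarrow> 'a tensor2 \<Rightarrow> 'a tensor1 \<Rightarrow> bool"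
  where "holomorphic_field N A J V \<longleftrightarrow>
    (\<forall>c\<in>A. \<forall>x\<in>coord_range c. \<forall>i<N. \<forall>j<N. lie_deriv_endo N V J c x i j = 0)"

end

theory Submission
  imports Defs
begin

text \<open>
  The example is a Kodaira surface, the quotient of \<open>\<complex>\<^sup>2\<close> by the maps
  \<open>(z, w) \<mapsto> (z + \<alpha>, w + cnj \<alpha> z + |\<alpha>|\<^sup>2 / 2 + k + \<i> l)\<close> with \<open>\<alpha>\<close> a Gaussian integer and \<open>k, l\<close> integers.
  These are holomorphic and add \<open>k\<close> to \<open>t = Re w - |z|\<^sup>2 / 2\<close>. Hence \<open>dt\<close>, \<open>d\<^sup>c t\<close> and any function \<open>h(t)\<close>
  of period \<open>1\<close> descend to the quotient, and so does the Hermitian metric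
  \<open>g = dx\<^sub>0\<^sup>2 + dx\<^sub>1\<^sup>2 + h(t) (dt\<^sup>2 + (d\<^sup>c t)\<^sup>2)\<close> for positive \<open>h\<close>, where \<open>z = x\<^sub>0 + \<i> x\<^sub>1\<close> and
  \<open>w = x\<^sub>2 + \<i> x\<^sub>3\<close>.

  Its fundamental form is \<open>\<omega> = dx\<^sub>0 \<and> dx\<^sub>1 + h dt \<and> d\<^sup>c t\<close>. From \<open>d d\<^sup>c t = - 2 dx\<^sub>0 \<and> dx\<^sub>1\<close> follows
  \<open>d\<omega> = 2 h dt \<and> dx\<^sub>0 \<and> dx\<^sub>1 = \<theta> \<and> \<omega>\<close> with the closed form \<open>\<theta> = 2 h(t) dt\<close> (\<open>ext_deriv_kodaira_form\<close>).
  The dual of \<open>\<theta>\<close> is \<open>2 \<partial>/\<partial>x\<^sub>2\<close> for every choice of \<open>h\<close>, because \<open>h\<close> cancels against the length of that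
  vector (\<open>metric_dual_lee\<close>); it is holomorphic, having constant coefficients in the coordinates \<open>z, w\<close>.
  But \<open>|\<theta>|\<^sup>2 = 4 h(t)\<close>, so that \<open>\<theta>\<close> is not parallel when \<open>h\<close> is not constant. Concretely,
  \<open>(\<nabla>\<^sub>2 \<theta>)\<^sub>2 = h'(t)\<close> (\<open>cov_deriv_lee\<close>), and \<open>h(t) = 2 + sin (2 \<pi> t)\<close>. As \<open>\<omega>\<close> determines the Lee form
  (\<open>lee_form_kodaira_unique\<close>), no other Lee form can be parallel either.

  The charts are the local inverses of the projection on small cells. Their transition maps are
  locally deck transformations (\<open>transition_locally_deck\<close>), so that tensor fields on the quotient are
  given by deck-invariant formulas on \<open>\<complex>\<^sup>2\<close>, with the standard complex structure in every chart.
\<close>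

section \<open>Elementary functions\<close>

text \<open>
  All components of the tensor fields below are polynomials in the coordinates and in sines and
  cosines of polynomials. This class is closed under partial differentiation and consists of
  continuous functions, so membership in it yields smoothness of all orders at once.
\<close>

inductive_set elementary :: "((nat \<Rightarrow> real) \<Rightarrow> real) set"
  where
    const: "(\<lambda>_. c) \<in> elementary"
  | coord: "(\<lambda>x. x i) \<in> elementary"
  | add: "f \<in> elementary \<Longrightarrow> g \<in> elementary \<Longrightarrow> (\<lambda>x. f x + g x) \<in> elementary"
  | mult: "f \<in> elementary \<Longrightarrow> g \<in> elementary \<Longrightarrow> (\<lambda>x. f x * g x) \<in> elementary"
  | sin: "f \<in> elementary \<Longrightarrow> (\<lambda>x. sin (f x)) \<in> elementary"
  | cos: "f \<in> elementary \<Longrightarrow> (\<lambda>x. cos (f x)) \<in> elementary"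

lemma elementary_uminus: "f \<in> elementary \<Longrightarrow> (\<lambda>x. - f x) \<in> elementary"
  using elementary.mult[OF elementary.const[of "-1"], of f] by simp

lemma elementary_diff:
  "f \<in> elementary \<Longrightarrow> g \<in> elementary \<Longrightarrow> (\<lambda>x. f x - g x) \<in> elementary"
  using elementary.add[OF _ elementary_uminus, of f g] by simp

lemma elementary_divide_const: "f \<in> elementary \<Longrightarrow> (\<lambda>x. f x / c) \<in> elementary"
  using elementary.mult[OF _ elementary.const[of "1 / c"], of f] by simp

lemma elementary_power2: "f \<in> elementary \<Longrightarrow> (\<lambda>x. (f x)\<^sup>2) \<in> elementary"
  using elementary.mult[of f f] by (simp add: power2_eq_square)

lemma elementary_if:
  "(P \<Longrightarrow> f \<in> elementary) \<Longrightarrow> (\<not> P \<Longrightarrow> g \<in> elementary) \<Longrightarrow> (\<lambda>x. if P then f x else g x) \<in> elementary"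
  by (cases P) simp_all

lemmas elementary_intros =
  elementary.intros elementary_uminus elementary_diff elementary_divide_const elementary_power2
  elementary_if

lemma elementary_has_pderiv:
  assumes "f \<in> elementary"
  shows "\<exists>f'\<in>elementary. \<forall>x. ((\<lambda>t. f (x(i := t))) has_real_derivative f' x) (at (x i))"
  using assms
proof induction
  case (const c)
  show ?case by (rule bexI[OF _ elementary.const[of 0]]) simp
next
  case (coord j)
  show ?case
    by (rule bexI[OF _ elementary.const[of "if j = i then 1 else 0"]]) auto
next
  case (add f g)
  then obtain f' g' where "f' \<in> elementary" "g' \<in> elementary"
    and d: "\<And>x. ((\<lambda>t. f (x(i := t))) has_real_derivative f' x) (at (x i))"
      "\<And>x. ((\<lambda>t. g (x(i := t))) has_real_derivative g' x) (at (x i))"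
    by blast
  then show ?case
    by (intro bexI[of _ "\<lambda>x. f' x + g' x"] allI elementary_intros DERIV_add d)
next
  case (mult f g)
  then obtain f' g' where "f' \<in> elementary" "g' \<in> elementary"
    and d: "\<And>x. ((\<lambda>t. f (x(i := t))) has_real_derivative f' x) (at (x i))"
      "\<And>x. ((\<lambda>t. g (x(i := t))) has_real_derivative g' x) (at (x i))"
    by blast
  then show ?case
  proof (intro bexI[of _ "\<lambda>x. f' x * g x + g' x * f x"] allI elementary_intros mult.hyps)
    show "((\<lambda>t. f (x(i := t)) * g (x(i := t))) has_real_derivative f' x * g x + g' x * f x) (at (x i))" for x
      using DERIV_mult[OF d(1)[of x] d(2)[of x]] by simp
  qed
next
  case (sin f)
  then obtain f' where "f' \<in> elementary"
    and d: "\<And>x. ((\<lambda>t. f (x(i := t))) has_real_derivative f' x) (at (x i))"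
    by blast
  then show ?case
  proof (intro bexI[of _ "\<lambda>x. cos (f x) * f' x"] allI elementary_intros sin.hyps)
    show "((\<lambda>t. sin (f (x(i := t)))) has_real_derivative cos (f x) * f' x) (at (x i))" for x
      using DERIV_fun_sin[OF d[of x]] by simp
  qed
next
  case (cos f)
  then obtain f' where "f' \<in> elementary"
    and d: "\<And>x. ((\<lambda>t. f (x(i := t))) has_real_derivative f' x) (at (x i))"
    by blast
  then show ?case
  proof (intro bexI[of _ "\<lambda>x. - sin (f x) * f' x"] allI elementary_intros cos.hyps)
    show "((\<lambda>t. cos (f (x(i := t)))) has_real_derivative - sin (f x) * f' x) (at (x i))" for x
      using DERIV_fun_cos[OF d[of x]] by simp
  qed
qed

lemma pderiv_at_eqI:
  "((\<lambda>t. f (x(i := t))) has_real_derivative D) (at (x i)) \<Longrightarrow> pderiv_at i f x = D"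
  by (simp add: pderiv_at_def DERIV_imp_deriv)

lemma elementary_pderiv_at:
  assumes "f \<in> elementary"
  shows "pderiv_at i f \<in> elementary"
proof -
  obtain f' where f': "f' \<in> elementary"
    "\<And>x. ((\<lambda>t. f (x(i := t))) has_real_derivative f' x) (at (x i))"
    using elementary_has_pderiv[OF assms] by blast
  then have "pderiv_at i f = f'"
    by (intro ext pderiv_at_eqI)
  with f' show ?thesis by simp
qed

lemma elementary_iter_pderiv: "f \<in> elementary \<Longrightarrow> iter_pderiv is f \<in> elementary"
  by (induction "is") (auto simp: iter_pderiv_def elementary_pderiv_at)

lemma elementary_continuous_on: "f \<in> elementary \<Longrightarrow> continuous_on S f"
  by (induction rule: elementary.induct)
    (auto intro!: continuous_intros continuous_on_subset[OF continuous_on_product_coordinates])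


section \<open>Locality of smoothness\<close>

lemma Euclidean_space_eq: "Euclidean_space N = top_of_set {x. \<forall>i\<ge>N. x i = 0}"
  by (simp add: Euclidean_space_def euclidean_product_topology)

lemma continuous_map_Euclidean_space_real_iff:
  "continuous_map (subtopology (Euclidean_space N) S) euclideanreal f \<longleftrightarrow>
    continuous_on ({x. \<forall>i\<ge>N. x i = 0} \<inter> S) f"
  by (simp add: Euclidean_space_eq subtopology_subtopology continuous_map_iff_continuous)

lemma openin_Euclidean_space_coordinate_line:
  assumes W: "openin (Euclidean_space N) W" and x: "x \<in> W" and i: "i < N"
  shows "\<forall>\<^sub>F t in nhds (x i). x(i := t) \<in> W"
proof -
  obtain T where T: "open T" "W = T \<inter> {x. \<forall>i\<ge>N. x i = 0}"
    using W by (auto simp: Euclidean_space_eq openin_open)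
  have "continuous_on UNIV (\<lambda>t. x(i := t))"
  proof (rule continuous_on_coordinatewise_then_product)
    show "continuous_on UNIV (\<lambda>t. (x(i := t)) j)" for j
      by (cases "j = i") (auto intro!: continuous_intros)
  qed
  then have "open ((\<lambda>t. x(i := t)) -` T)"
    using T(1) by (simp add: continuous_on_open_vimage)
  then have "\<forall>\<^sub>F t in nhds (x i). t \<in> (\<lambda>t. x(i := t)) -` T"
    by (rule eventually_nhds_in_open) (use x T in auto)
  then show ?thesis
    by (rule eventually_mono) (use x T i in auto)
qed

lemma pderiv_at_cong:
  assumes "openin (Euclidean_space N) W" "x \<in> W" "i < N" and eq: "\<And>y. y \<in> W \<Longrightarrow> f y = g y"
  shows "pderiv_at i f x = pderiv_at i g x"
  unfolding pderiv_at_def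
  by (rule deriv_cong_ev[OF eventually_mono[OF openin_Euclidean_space_coordinate_line[OF assms(1-3)]]])
    (auto intro: eq)

text \<open>
  The set must be open for the induction: a partial derivative at a point involves the values on a
  short segment around it, which stays in an open set.
\<close>

lemma iter_pderiv_cong:
  assumes "openin (Euclidean_space N) W" "set is \<subseteq> {..<N}" and eq: "\<And>y. y \<in> W \<Longrightarrow> f y = g y"
  shows "x \<in> W \<Longrightarrow> iter_pderiv is f x = iter_pderiv is g x"
  using assms(2)
proof (induction "is" arbitrary: x)
  case Nil
  then show ?case by (simp add: iter_pderiv_def eq)
next
  case (Cons i "is")
  then have "pderiv_at i (iter_pderiv is f) x = pderiv_at i (iter_pderiv is g) x"
    by (intro pderiv_at_cong[OF assms(1)]) auto
  then show ?case by (simp add: iter_pderiv_def)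
qed

text \<open>
  The local form is what transition maps require: the overlap of two charts may be disconnected,
  and the transition map is then a different affine map on each component.
\<close>

lemma smooth_fun_on_locally_elementary:
  assumes "\<And>x. x \<in> S \<Longrightarrow> \<exists>W g. openin (Euclidean_space N) W \<and> x \<in> W \<and> g \<in> elementary \<and> (\<forall>y\<in>W. f y = g y)"
  shows "smooth_fun_on N S f"
  unfolding smooth_fun_on_def continuous_map_Euclidean_space_real_iff
proof (intro allI impI conjI ballI)
  fix "is" :: "nat list"
  assume "is": "set is \<subseteq> {..<N}"
  show "continuous_on ({x. \<forall>i\<ge>N. x i = 0} \<inter> S) (iter_pderiv is f)"
    unfolding continuous_on_def
  proof (intro ballI)
    fix x assume x: "x \<in> {x. \<forall>i\<ge>N. x i = 0} \<inter> S"
    then obtain W g where W: "openin (Euclidean_space N) W" "x \<in> W"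
      and g: "g \<in> elementary" "\<And>y. y \<in> W \<Longrightarrow> f y = g y"
      using assms[of x] by blast
    have eq: "iter_pderiv is f y = iter_pderiv is g y" if "y \<in> W" for y
      by (rule iter_pderiv_cong[OF W(1) "is" _ that]) (rule g(2))
    obtain T where T: "open T" "W = T \<inter> {x. \<forall>i\<ge>N. x i = 0}"
      using W by (auto simp: Euclidean_space_eq openin_open)
    have "(iter_pderiv is g \<longlongrightarrow> iter_pderiv is g x) (at x within {x. \<forall>i\<ge>N. x i = 0} \<inter> S)"
      using elementary_continuous_on[OF elementary_iter_pderiv[OF g(1)]] x
      unfolding continuous_on_def by blast
    moreover have "\<forall>\<^sub>F y in at x within {x. \<forall>i\<ge>N. x i = 0} \<inter> S. iter_pderiv is g y = iter_pderiv is f y"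
      unfolding eventually_at_topological
    proof (intro exI[of _ T] conjI ballI impI)
      fix y assume "y \<in> T" "y \<in> {x. \<forall>i\<ge>N. x i = 0} \<inter> S"
      then have "y \<in> W" using T(2) by simp
      then show "iter_pderiv is g y = iter_pderiv is f y" by (rule eq[symmetric])
    qed (use T W(2) in auto)
    ultimately show "(iter_pderiv is f \<longlongrightarrow> iter_pderiv is f x) (at x within {x. \<forall>i\<ge>N. x i = 0} \<inter> S)"
      unfolding eq[OF W(2)] by (rule Lim_transform_eventually)
  qed
  fix x i assume x: "x \<in> S" and i: "i < N"
  then obtain W g where W: "openin (Euclidean_space N) W" "x \<in> W"
    and g: "g \<in> elementary" "\<And>y. y \<in> W \<Longrightarrow> f y = g y"
    using assms[OF x] by blast
  obtain D where D: "((\<lambda>t. iter_pderiv is g (x(i := t))) has_real_derivative D) (at (x i))"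
    using elementary_has_pderiv[OF elementary_iter_pderiv[OF g(1)]] by blast
  have "\<forall>\<^sub>F t in nhds (x i). iter_pderiv is f (x(i := t)) = iter_pderiv is g (x(i := t))"
    by (rule eventually_mono[OF openin_Euclidean_space_coordinate_line[OF W i]])
      (rule iter_pderiv_cong[OF W(1) "is"], rule g(2))
  then have "((\<lambda>t. iter_pderiv is f (x(i := t))) has_real_derivative D) (at (x i))"
    by (simp add: DERIV_cong_ev[OF refl _ refl] D)
  then show "(\<lambda>t. iter_pderiv is f (x(i := t))) differentiable at (x i)"
    by (auto simp: real_differentiable_def)
qed

lemma smooth_fun_on_elementary:
  "f \<in> elementary \<Longrightarrow> S \<subseteq> topspace (Euclidean_space N) \<Longrightarrow> smooth_fun_on N S f"
  by (rule smooth_fun_on_locally_elementary) (use openin_topspace in blast)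


section \<open>Quotient topologies\<close>

text \<open>
  Carrying the quotient topology on the range of an arbitrary map lets orbits be represented by
  points of the same type.
\<close>

definition quotient_topology :: "'a topology \<Rightarrow> ('a \<Rightarrow> 'b) \<Rightarrow> 'b topology"
  where "quotient_topology X f =
    topology (\<lambda>U. U \<subseteq> f ` topspace X \<and> openin X {x \<in> topspace X. f x \<in> U})"

lemma openin_quotient_topology:
  "openin (quotient_topology X f) U \<longleftrightarrow> U \<subseteq> f ` topspace X \<and> openin X {x \<in> topspace X. f x \<in> U}"
proof -
  have "istopology (\<lambda>U. U \<subseteq> f ` topspace X \<and> openin X {x \<in> topspace X. f x \<in> U})"
    unfolding istopology_def
  proof (intro conjI allI impI)
    fix S T
    assume *: "S \<subseteq> f ` topspace X \<and> openin X {x \<in> topspace X. f x \<in> S}"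
      "T \<subseteq> f ` topspace X \<and> openin X {x \<in> topspace X. f x \<in> T}"
    have "{x \<in> topspace X. f x \<in> S \<inter> T} = {x \<in> topspace X. f x \<in> S} \<inter> {x \<in> topspace X. f x \<in> T}"
      by blast
    with * show "openin X {x \<in> topspace X. f x \<in> S \<inter> T}"
      by (simp add: openin_Int)
    show "S \<inter> T \<subseteq> f ` topspace X"
      using * by blast
  next
    fix \<K>
    assume *: "\<forall>K\<in>\<K>. K \<subseteq> f ` topspace X \<and> openin X {x \<in> topspace X. f x \<in> K}"
    have "{x \<in> topspace X. f x \<in> \<Union> \<K>} = (\<Union>K\<in>\<K>. {x \<in> topspace X. f x \<in> K})"
      by blast
    with * show "openin X {x \<in> topspace X. f x \<in> \<Union> \<K>}"
      by (simp add: openin_clauses(3))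
    show "\<Union> \<K> \<subseteq> f ` topspace X"
      using * by blast
  qed
  then show ?thesis by (simp add: quotient_topology_def)
qed

lemma topspace_quotient_topology: "topspace (quotient_topology X f) = f ` topspace X"
proof
  have "{x \<in> topspace X. f x \<in> f ` topspace X} = topspace X"
    by blast
  then have "openin (quotient_topology X f) (f ` topspace X)"
    by (simp add: openin_quotient_topology)
  then show "f ` topspace X \<subseteq> topspace (quotient_topology X f)"
    by (rule openin_subset)
  show "topspace (quotient_topology X f) \<subseteq> f ` topspace X"
    using openin_quotient_topology[of X f] openin_topspace by blast
qed

lemma continuous_map_quotient_topology: "continuous_map X (quotient_topology X f) f"
  by (auto simp: continuous_map_def topspace_quotient_topology openin_quotient_topology)

lemma Hausdorff_space_open_map_image:
  assumes f: "open_map X Y f" "f ` topspace X = topspace Y"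
    and sep: "\<And>x y. x \<in> topspace X \<Longrightarrow> y \<in> topspace X \<Longrightarrow> f x \<noteq> f y \<Longrightarrow>
      \<exists>U V. openin X U \<and> openin X V \<and> x \<in> U \<and> y \<in> V \<and> (\<forall>u\<in>U. \<forall>v\<in>V. f u \<noteq> f v)"
  shows "Hausdorff_space Y"
  unfolding Hausdorff_space_def
proof (intro allI impI)
  fix a b assume ab: "a \<in> topspace Y \<and> b \<in> topspace Y \<and> a \<noteq> b"
  then have "a \<in> f ` topspace X" "b \<in> f ` topspace X"
    by (simp_all add: f(2))
  then obtain x y where xy: "x \<in> topspace X" "y \<in> topspace X" "f x \<noteq> f y" "a = f x" "b = f y"
    using ab by (elim imageE) simp
  from sep[OF this(1-3)] obtain U V where "openin X U" "openin X V" "x \<in> U" "y \<in> V"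
    "\<forall>u\<in>U. \<forall>v\<in>V. f u \<noteq> f v" by blast
  with xy f(1) show "\<exists>U V. openin Y U \<and> openin Y V \<and> a \<in> U \<and> b \<in> V \<and> disjnt U V"
    by (intro exI[of _ "f ` U"] exI[of _ "f ` V"]) (auto simp: open_map_def disjnt_def)
qed

lemma homeomorphic_map_inv_into:
  assumes f: "continuous_map X Y f" "open_map X Y f" and U: "openin X U" and inj: "inj_on f U"
  shows "homeomorphic_map (subtopology Y (f ` U)) (subtopology X U) (inv_into U f)"
proof -
  have top: "topspace (subtopology X U) = U"
    using openin_subset[OF U] by auto
  have topY: "topspace (subtopology Y (f ` U)) = f ` U"
    using f(2) U by (metis Int_absorb1 open_map_def openin_subset topspace_subtopology)
  have "homeomorphic_map (subtopology X U) (subtopology Y (f ` U)) f"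
  proof (rule bijective_open_imp_homeomorphic_map)
    show "continuous_map (subtopology X U) (subtopology Y (f ` U)) f"
      by (simp add: continuous_map_in_subtopology continuous_map_from_subtopology f(1) image_mono)
    show "open_map (subtopology X U) (subtopology Y (f ` U)) f"
      using open_map_from_subtopology[OF f(2) U] by (intro open_map_into_subtopology) auto
  qed (use top topY inj in simp_all)
  then obtain g where g: "homeomorphic_maps (subtopology X U) (subtopology Y (f ` U)) f g"
    by (auto simp: homeomorphic_map_maps)
  have "homeomorphic_map (subtopology Y (f ` U)) (subtopology X U) g"
    using g homeomorphic_maps_map by blast
  moreover have "g y = inv_into U f y" if "y \<in> topspace (subtopology Y (f ` U))" for y
    using that g inj unfolding homeomorphic_maps_def top topY by force
  ultimately show ?thesis by (rule homeomorphic_map_eq)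
qed

lemma second_countable_Euclidean_space: "second_countable (Euclidean_space N)"
proof -
  obtain B :: "(nat \<Rightarrow> real) set set" where B: "countable B" "topological_basis B"
    using ex_countable_basis by blast
  then have "second_countable (euclidean :: (nat \<Rightarrow> real) topology)"
    unfolding second_countable_def
    by (intro exI[of _ B] conjI ballI allI impI)
      (simp_all add: topological_basis_open, metis topological_basisE)
  then show ?thesis
    by (simp add: Euclidean_space_eq second_countable_subtopology)
qed


section \<open>The group of deck transformations\<close>

lemma sum_lessThan_4: "(\<Sum>k<4::nat. f k) = f 0 + f 1 + f 2 + (f 3 :: real)"
  by (simp add: eval_nat_numeral)

lemma all_less_4: "(\<forall>i<4::nat. P i) \<longleftrightarrow> P 0 \<and> P 1 \<and> P 2 \<and> P 3"
  by (auto simp: eval_nat_numeral less_Suc_eq)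

abbreviation E4 :: "(nat \<Rightarrow> real) set"
  where "E4 \<equiv> topspace (Euclidean_space 4)"

text \<open>
  With \<open>z = x\<^sub>0 + \<i> x\<^sub>1\<close> and \<open>w = x\<^sub>2 + \<i> x\<^sub>3\<close> this is \<open>t = Re w - |z|\<^sup>2 / 2\<close>.
\<close>

definition height :: "(nat \<Rightarrow> real) \<Rightarrow> real"
  where "height x = x 2 - ((x 0)\<^sup>2 + (x 1)\<^sup>2) / 2"

text \<open>
  For \<open>\<alpha> = a + \<i> b\<close> this is the holomorphic affine map
  \<open>(z, w) \<mapsto> (z + \<alpha>, w + cnj \<alpha> z + |\<alpha>|\<^sup>2 / 2 + k + \<i> l)\<close>.
\<close>

definition deck :: "int \<Rightarrow> int \<Rightarrow> int \<Rightarrow> int \<Rightarrow> (nat \<Rightarrow> real) \<Rightarrow> nat \<Rightarrow> real"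
  where "deck a b k l x i =
    (if i = 0 then x 0 + a
     else if i = 1 then x 1 + b
     else if i = 2 then x 2 + (a * x 0 + b * x 1 + (a\<^sup>2 + b\<^sup>2) / 2) + k
     else if i = 3 then x 3 + (a * x 1 - b * x 0) + l
     else 0)"

lemma deck_in_E4: "deck a b k l x \<in> E4"
  by (simp add: deck_def topspace_Euclidean_space)

lemma deck_0: "x \<in> E4 \<Longrightarrow> deck 0 0 0 0 x = x"
  by (auto simp: deck_def topspace_Euclidean_space fun_eq_iff)

text \<open>
  The deck transformations form a group, of Heisenberg type: the translations in \<open>z\<close> commute only up
  to the central translations in \<open>Im w\<close>, because \<open>Im (cnj \<alpha>' \<alpha>)\<close> enters the last parameter. It is
  an integer, so the parameters stay integral.
\<close>

lemma deck_deck: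
  "deck a' b' k' l' (deck a b k l x) = deck (a' + a) (b' + b) (k' + k) (l' + l + a' * b - b' * a) x"
  by (auto simp: deck_def fun_eq_iff power2_eq_square field_simps)

lemma elementary_deck: "(\<lambda>x. deck a b k l x i) \<in> elementary"
  unfolding deck_def by (intro elementary_intros)

lemma elementary_height: "height \<in> elementary"
  unfolding height_def by (intro elementary_intros)

text \<open>
  The terms of the third component of a deck transformation are chosen for this: expanding
  \<open>|z + \<alpha>|\<^sup>2 / 2\<close> produces \<open>Re (cnj \<alpha> z) + |\<alpha>|\<^sup>2 / 2\<close>, which they cancel.
\<close>

lemma height_deck: "height (deck a b k l x) = height x + k"
  by (simp add: height_def deck_def power2_eq_square field_simps)

definition orbit :: "(nat \<Rightarrow> real) \<Rightarrow> (nat \<Rightarrow> real) set"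
  where "orbit x = {deck a b k l x | a b k l. True}"

text \<open>
  Points of the quotient have to be sequences again, so each orbit is replaced by a chosen member.
  The choice is immaterial, as the quotient topology depends only on the fibres.
\<close>

definition representative :: "(nat \<Rightarrow> real) \<Rightarrow> nat \<Rightarrow> real"
  where "representative x = (SOME y. y \<in> orbit x)"

lemma orbit_deck: "orbit (deck a b k l x) = orbit x"
proof -
  have sub: "orbit (deck a b k l x) \<subseteq> orbit x" for a b k l x
    by (auto simp: orbit_def deck_deck)
  have "deck a' b' k' l' x = deck (a' - a) (b' - b) (k' - k) (l' - l - (a' - a) * b + (b' - b) * a) (deck a b k l x)" for a' b' k' l'
    by (simp add: deck_deck)
  then have "orbit x \<subseteq> orbit (deck a b k l x)"
    unfolding orbit_def by blast
  with sub show ?thesis by blast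
qed

lemma representative_deck: "representative (deck a b k l x) = representative x"
  by (simp add: representative_def orbit_deck)

lemma representative_eq_iff:
  assumes "x \<in> E4" "y \<in> E4"
  shows "representative x = representative y \<longleftrightarrow> (\<exists>a b k l. y = deck a b k l x)"
proof
  have rep: "representative z \<in> orbit z" for z
    unfolding representative_def by (rule someI[of _ "deck 0 0 0 0 z"]) (auto simp: orbit_def)
  assume "representative x = representative y"
  moreover have "orbit (representative z) = orbit z" for z
  proof -
    obtain a b k l where "representative z = deck a b k l z"
      using rep[of z] by (auto simp: orbit_def)
    then show ?thesis by (simp add: orbit_deck)
  qed
  ultimately have "orbit x = orbit y" by metis
  moreover have "y \<in> orbit y"
    unfolding orbit_def using deck_0[OF assms(2), symmetric] by blast
  ultimately have "y \<in> orbit x" by simp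
  then show "\<exists>a b k l. y = deck a b k l x"
    by (auto simp: orbit_def)
qed (auto simp: representative_deck)

text \<open>
  Orbit equivalence is the integrality of four continuous functions. This form is what
  separates orbits, since \<open>\<int>\<close> is closed. The last function is \<open>y\<^sub>3 - x\<^sub>3 - (a x\<^sub>1 - b x\<^sub>0)\<close> after
  eliminating the translation parameters \<open>a = y\<^sub>0 - x\<^sub>0\<close> and \<open>b = y\<^sub>1 - x\<^sub>1\<close>.
\<close>

lemma deck_iff:
  assumes "x \<in> E4" "y \<in> E4"
  shows "(\<exists>a b k l. y = deck a b k l x) \<longleftrightarrow>
    y 0 - x 0 \<in> \<int> \<and> y 1 - x 1 \<in> \<int> \<and> height y - height x \<in> \<int> \<and> y 3 - x 3 - (y 0 * x 1 - y 1 * x 0) \<in> \<int>"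
    (is "?lhs \<longleftrightarrow> ?rhs")
proof
  assume ?lhs
  then show ?rhs
    by (auto simp: height_deck) (auto simp: deck_def algebra_simps)
next
  assume ?rhs
  then obtain a b k l :: int where eq: "y 0 = x 0 + a" "y 1 = x 1 + b" "height y = height x + k"
    "y 3 = x 3 + (y 0 * x 1 - y 1 * x 0) + l"
    by (elim conjE Ints_cases) (auto simp: algebra_simps)
  have "y i = deck a b k l x i" for i
  proof -
    consider "i = 0" | "i = 1" | "i = 2" | "i = 3" | "i \<ge> 4" by linarith
    then show ?thesis
    proof cases
      case 3
      then show ?thesis
        using eq(3) unfolding height_def eq(1,2)
        by (simp add: deck_def power2_eq_square field_simps)
    qed (use assms eq in \<open>auto simp: deck_def topspace_Euclidean_space algebra_simps\<close>)
  qed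
  then show ?lhs by blast
qed


section \<open>The Kodaira surface\<close>

definition kodaira :: "(nat \<Rightarrow> real) topology"
  where "kodaira = quotient_topology (Euclidean_space 4) representative"

lemma topspace_kodaira: "topspace kodaira = representative ` E4"
  by (simp add: kodaira_def topspace_quotient_topology)

lemma continuous_map_representative: "continuous_map (Euclidean_space 4) kodaira representative"
  by (simp add: kodaira_def continuous_map_quotient_topology)

lemma continuous_map_deck: "continuous_map (Euclidean_space 4) (Euclidean_space 4) (deck a b k l)"
proof -
  have "continuous_on E4 (deck a b k l)"
    by (intro continuous_on_coordinatewise_then_product elementary_continuous_on elementary_deck)
  then show ?thesis
    using cm_Euclidean_space_iff_continuous_on[of 4 UNIV 4 "deck a b k l"]
    by (simp add: deck_in_E4)
qed

text \<open>
  The saturation of an open set is the union of its preimages under all deck transformations, which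
  are continuous.
\<close>

lemma open_map_representative: "open_map (Euclidean_space 4) kodaira representative"
  unfolding open_map_def
proof (intro allI impI)
  fix U assume U: "openin (Euclidean_space 4) U"
  then have sub: "U \<subseteq> E4" by (rule openin_subset)
  have "{x \<in> E4. representative x \<in> representative ` U} =
      (\<Union>(a, b, k, l)\<in>UNIV. {x \<in> E4. deck a b k l x \<in> U})" (is "?L = ?R")
  proof
    show "?L \<subseteq> ?R"
    proof
      fix x assume "x \<in> ?L"
      then obtain y where "x \<in> E4" "y \<in> U" "representative x = representative y" by blast
      then obtain a b k l where "y = deck a b k l x"
        using representative_eq_iff sub by blast
      with \<open>x \<in> E4\<close> \<open>y \<in> U\<close> show "x \<in> ?R" by auto
    qed
    show "?R \<subseteq> ?L"
    proof
      fix x assume "x \<in> ?R"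
      then obtain a b k l where "x \<in> E4" "deck a b k l x \<in> U" by blast
      then show "x \<in> ?L"
        using imageI[of "deck a b k l x" U representative] by (simp add: representative_deck)
    qed
  qed
  moreover have "openin (Euclidean_space 4) {x \<in> E4. deck a b k l x \<in> U}" for a b k l
    using continuous_map_deck U by (rule openin_continuous_map_preimage)
  ultimately have "openin (Euclidean_space 4) {x \<in> E4. representative x \<in> representative ` U}"
    by (auto intro!: openin_Union)
  then show "openin kodaira (representative ` U)"
    using sub by (auto simp: kodaira_def openin_quotient_topology)
qed

text \<open>
  Orbit equivalence is a closed relation and the projection is open, so inequivalent points have
  neighbourhoods with disjoint images.
\<close>

lemma Hausdorff_kodaira: "Hausdorff_space kodaira"
proof (rule Hausdorff_space_open_map_image[OF open_map_representative])
  show "representative ` E4 = topspace kodaira"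
    by (simp add: topspace_kodaira)
  fix x y assume xy: "x \<in> E4" "y \<in> E4" "representative x \<noteq> representative y"
  define R where "R = {(x, y). y 0 - x 0 \<in> \<int> \<and> y 1 - x 1 \<in> \<int> \<and>
    height y - height x \<in> \<int> \<and> y 3 - x 3 - (y 0 * x 1 - y 1 * x (0::nat)) \<in> (\<int> :: real set)}"
  have cont: "continuous_on UNIV (\<lambda>z. f (fst z))" "continuous_on UNIV (\<lambda>z. f (snd z))"
    if "f \<in> elementary" for f :: "(nat \<Rightarrow> real) \<Rightarrow> real"
    by (rule continuous_on_compose2[OF elementary_continuous_on[OF that, of UNIV]];
        intro continuous_intros subset_UNIV)+
  have "closed R"
  proof -
    have R: "R = (\<lambda>z. snd z 0 - fst z 0) -` \<int> \<inter> (\<lambda>z. snd z 1 - fst z 1) -` \<int> \<inter>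
        (\<lambda>z. height (snd z) - height (fst z)) -` \<int> \<inter>
        (\<lambda>z. snd z 3 - fst z 3 - (snd z 0 * fst z 1 - snd z 1 * fst z 0)) -` \<int>"
      by (auto simp: R_def)
    show ?thesis
      unfolding R
      by (intro closed_Int continuous_closed_vimage closed_Ints continuous_intros cont
          elementary.coord elementary_height)
  qed
  moreover have "(x, y) \<notin> R"
    using xy representative_eq_iff deck_iff by (auto simp: R_def)
  ultimately have "open (- R)" "(x, y) \<in> - R"
    by (auto simp: open_Compl)
  then obtain A B where AB: "open A" "open B" "(x, y) \<in> A \<times> B" "A \<times> B \<subseteq> - R"
    by (rule open_prod_elim)
  have "representative u \<noteq> representative v" if "u \<in> E4 \<inter> A" "v \<in> E4 \<inter> B" for u v
  proof -
    have "(u, v) \<notin> R" using that AB(4) by blast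
    then show ?thesis
      using representative_eq_iff[of u v] deck_iff[of u v] that by (auto simp: R_def)
  qed
  moreover have "openin (Euclidean_space 4) (E4 \<inter> A)" "openin (Euclidean_space 4) (E4 \<inter> B)"
    using AB(1,2) by (simp_all add: Euclidean_space_eq openin_open_Int)
  moreover have "x \<in> E4 \<inter> A" "y \<in> E4 \<inter> B"
    using xy(1,2) AB(3) by simp_all
  ultimately show "\<exists>U V. openin (Euclidean_space 4) U \<and> openin (Euclidean_space 4) V \<and> x \<in> U \<and> y \<in> V \<and>
      (\<forall>u\<in>U. \<forall>v\<in>V. representative u \<noteq> representative v)"
    by blast
qed

lemma second_countable_kodaira: "second_countable kodaira"
  by (rule second_countable_open_map_image[OF continuous_map_representative open_map_representative _
        second_countable_Euclidean_space])
    (simp add: topspace_kodaira)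

text \<open>
  The unit cube meets every orbit: the parameters \<open>a\<close> and \<open>b\<close> bring the first two coordinates into
  the unit interval, and then \<open>k\<close> and \<open>l\<close>, which translate only the last two, adjust those.
\<close>

lemma compact_kodaira: "compact_space kodaira"
proof -
  let ?B = "PiE UNIV (\<lambda>i::nat. if i < 4 then {0..1} else {0::real})"
  have "compactin euclideanreal (if i < 4 then {0..1} else {0})" for i :: nat
    by (cases "i < 4") simp_all
  then have "compactin (powertop_real UNIV) ?B"
    unfolding compactin_PiE by blast
  moreover have "?B \<subseteq> {x. \<forall>i\<ge>4. x i = 0}"
  proof (intro subsetI CollectI allI impI)
    fix x i assume x: "x \<in> ?B" and i: "i \<ge> (4::nat)"
    from PiE_mem[OF x UNIV_I[of i]] i show "x i = 0"
      by simp
  qed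
  ultimately have "compactin (Euclidean_space 4) ?B"
    unfolding Euclidean_space_def compactin_subtopology by blast
  then have "compactin kodaira (representative ` ?B)"
    by (rule image_compactin[OF _ continuous_map_representative])
  moreover have "representative ` ?B = topspace kodaira"
  proof
    show "representative ` ?B \<subseteq> topspace kodaira"
      using \<open>compactin kodaira (representative ` ?B)\<close> compactin_subset_topspace by blast
    show "topspace kodaira \<subseteq> representative ` ?B"
    proof
      fix p assume "p \<in> topspace kodaira"
      then obtain x where x: "x \<in> E4" "p = representative x"
        by (auto simp: topspace_kodaira)
      define a where "a = - \<lfloor>x 0\<rfloor>"
      define b where "b = - \<lfloor>x 1\<rfloor>"
      define k where "k = - \<lfloor>deck a b 0 0 x 2\<rfloor>"
      define l where "l = - \<lfloor>deck a b 0 0 x 3\<rfloor>"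
      have shift: "0 \<le> r + of_int (- \<lfloor>r\<rfloor>)" "r + of_int (- \<lfloor>r\<rfloor>) \<le> 1" for r :: real
        by linarith+
      have fib: "deck a b k l x 2 = deck a b 0 0 x 2 + k" "deck a b k l x 3 = deck a b 0 0 x 3 + l"
        by (simp_all add: deck_def)
      have "deck a b k l x i \<in> {0..1}" if "i < 4" for i
      proof -
        have "i = 0 \<or> i = 1 \<or> i = 2 \<or> i = 3" using that by linarith
        moreover have "deck a b k l x 0 \<in> {0..1}" "deck a b k l x 1 \<in> {0..1}"
          using shift[of "x 0"] shift[of "x 1"] by (auto simp: deck_def a_def b_def)
        moreover have "deck a b k l x 2 \<in> {0..1}" "deck a b k l x 3 \<in> {0..1}"
          using shift[of "deck a b 0 0 x 2", folded k_def] shift[of "deck a b 0 0 x 3", folded l_def]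
          by (simp_all add: fib)
        ultimately show ?thesis by blast
      qed
      moreover have "deck a b k l x i = 0" if "\<not> i < 4" for i
        using that by (simp add: deck_def)
      ultimately have "deck a b k l x \<in> ?B"
        by (simp add: PiE_iff)
      moreover have "p = representative (deck a b k l x)"
        by (simp add: x representative_deck)
      ultimately show "p \<in> representative ` ?B" by blast
    qed
  qed
  ultimately show ?thesis by (simp add: compact_space_def)
qed


section \<open>The holomorphic atlas\<close>

text \<open>
  Cells are small enough to contain at most one point of each orbit. Measuring the third coordinate
  by the height makes its displacement under a deck transformation an integer.
\<close>

definition cell :: "(nat \<Rightarrow> real) \<Rightarrow> (nat \<Rightarrow> real) set"
  where "cell p = {x \<in> E4. \<bar>x 0 - p 0\<bar> < 1 / 4 \<and> \<bar>x 1 - p 1\<bar> < 1 / 4 \<and>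
    \<bar>height x - height p\<bar> < 1 / 4 \<and> \<bar>x 3 - p 3\<bar> < 1 / 4}"

lemma cell_subset: "cell p \<subseteq> E4"
  by (auto simp: cell_def)

lemma cell_self: "p \<in> E4 \<Longrightarrow> p \<in> cell p"
  by (simp add: cell_def)

lemma openin_cell: "openin (Euclidean_space 4) (cell p)"
proof -
  have strip: "open {x. \<bar>f x - f p\<bar> < 1 / 4}" if "f \<in> elementary" for f
    by (intro open_Collect_less continuous_intros elementary_continuous_on[OF that])
  have "open ({x. \<bar>x 0 - p 0\<bar> < 1 / 4} \<inter> {x. \<bar>x 1 - p 1\<bar> < 1 / 4} \<inter>
      {x. \<bar>height x - height p\<bar> < 1 / 4} \<inter> {x. \<bar>x 3 - p 3\<bar> < 1 / 4})" (is "open ?S")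
    by (intro open_Int strip[OF elementary.coord] strip[OF elementary_height])
  moreover have "cell p = E4 \<inter> ?S"
    by (auto simp: cell_def)
  ultimately show ?thesis
    by (simp add: Euclidean_space_eq openin_open_Int)
qed

text \<open>
  Two points of a cell differ by less than \<open>1 / 2\<close> in each of the four controlled quantities. For
  points of one orbit the first three differences are integers and hence vanish; only then is the
  difference in the last coordinate an integer as well.
\<close>

lemma inj_on_representative_cell: "inj_on representative (cell p)"
proof (rule inj_onI)
  fix x y
  assume x: "x \<in> cell p" and y: "y \<in> cell p" and "representative x = representative y"
  then have "\<exists>a b k l. y = deck a b k l x"
    by (subst representative_eq_iff[symmetric]) (auto simp: cell_def)
  then obtain a b k l where deck: "y = deck a b k l x" by blast
  have small: "n = 0" if "\<bar>s - r\<bar> < 1 / 4" "\<bar>t - r\<bar> < 1 / 4" "t = s + of_int n"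
    for r s t :: real and n :: int
    using that by linarith
  have "a = 0" "b = 0" "k = 0"
    using x y small[of "x 0" "p 0" "y 0" a] small[of "x 1" "p 1" "y 1" b]
      small[of "height x" "height p" "height y" k]
    unfolding cell_def by (simp_all add: deck height_deck, simp_all add: deck_def)
  moreover from this have "l = 0"
    using x y small[of "x 3" "p 3" "y 3" l] unfolding cell_def by (simp add: deck deck_def)
  moreover have "x \<in> E4"
    using cell_subset x by blast
  ultimately show "x = y"
    using deck by (simp add: deck_0)
qed

definition cell_chart :: "(nat \<Rightarrow> real) \<Rightarrow> (nat \<Rightarrow> real) chart"
  where "cell_chart p = (representative ` cell p, inv_into (cell p) representative)"

definition kodaira_atlas :: "(nat \<Rightarrow> real) chart set"
  where "kodaira_atlas = cell_chart ` E4"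

lemma coord_range_cell_chart: "coord_range (cell_chart p) = cell p"
  by (simp add: coord_range_def cell_chart_def inv_into_image_cancel inj_on_representative_cell image_image)

lemma is_chart_cell_chart: "is_chart kodaira 4 (cell_chart p)"
  unfolding is_chart_def coord_range_cell_chart
  using openin_cell open_map_representative
    homeomorphic_map_inv_into[OF continuous_map_representative open_map_representative openin_cell
      inj_on_representative_cell]
  by (auto simp: cell_chart_def open_map_def)

lemma overlap_cell_chart:
  assumes "x \<in> overlap (cell_chart p) (cell_chart q)"
  shows "x \<in> cell p" "representative x \<in> representative ` cell q"
proof -
  obtain r where r: "r \<in> representative ` cell p" "r \<in> representative ` cell q"
    and x: "x = inv_into (cell p) representative r"
    using assms by (auto simp: overlap_def cell_chart_def)
  then show "x \<in> cell p" "representative x \<in> representative ` cell q"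
    by (simp_all add: inv_into_into f_inv_into_f)
qed

lemma transition_cell_chart:
  assumes x: "x \<in> cell p" and deck: "deck a b k l x \<in> cell q"
  shows "transition (cell_chart p) (cell_chart q) x = deck a b k l x"
proof -
  let ?inv = "inv_into (cell p) representative"
  have "inv_into (representative ` cell p) ?inv (?inv (representative x)) = representative x"
    by (rule inv_into_f_f) (use x in \<open>auto intro: inj_on_inv_into\<close>)
  moreover have "?inv (representative x) = x"
    by (rule inv_into_f_f[OF inj_on_representative_cell x])
  moreover have "inv_into (cell q) representative (representative (deck a b k l x)) = deck a b k l x"
    by (rule inv_into_f_f[OF inj_on_representative_cell deck])
  ultimately show ?thesis
    by (simp add: transition_def cell_chart_def representative_deck)
qed

lemma transition_locally_deck:
  assumes x: "x \<in> overlap (cell_chart p) (cell_chart q)"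
  shows "\<exists>a b k l W. openin (Euclidean_space 4) W \<and> x \<in> W \<and>
    (\<forall>y\<in>W. transition (cell_chart p) (cell_chart q) y = deck a b k l y)"
proof -
  obtain y where y: "y \<in> cell q" "representative x = representative y"
    using overlap_cell_chart(2)[OF x] by blast
  have xp: "x \<in> cell p"
    by (rule overlap_cell_chart(1)[OF x])
  then obtain a b k l where deck: "y = deck a b k l x"
    using representative_eq_iff[of x y] y cell_subset by blast
  \<comment> \<open>near \<open>x\<close> the same deck transformation leads into the target cell\<close>
  let ?W = "cell p \<inter> {z \<in> E4. deck a b k l z \<in> cell q}"
  have "openin (Euclidean_space 4) ?W"
    by (intro openin_Int openin_cell openin_continuous_map_preimage[OF continuous_map_deck openin_cell])
  moreover have "x \<in> ?W"
    using xp y deck cell_subset by auto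
  moreover have "transition (cell_chart p) (cell_chart q) y = deck a b k l y" if "y \<in> ?W" for y
    using that by (simp add: transition_cell_chart)
  ultimately show ?thesis by blast
qed

lemma compatible_cell_chart: "compatible 4 (cell_chart p) (cell_chart q)"
proof -
  have "smooth_fun_on 4 (overlap (cell_chart p) (cell_chart q))
      (\<lambda>x. transition (cell_chart p) (cell_chart q) x i)" for p q i
  proof (rule smooth_fun_on_locally_elementary)
    fix x assume x: "x \<in> overlap (cell_chart p) (cell_chart q)"
    obtain a b k l W where W: "openin (Euclidean_space 4) W" "x \<in> W"
      "\<forall>y\<in>W. transition (cell_chart p) (cell_chart q) y = deck a b k l y"
      using transition_locally_deck[OF x] by blast
    then show "\<exists>W g. openin (Euclidean_space 4) W \<and> x \<in> W \<and> g \<in> elementary \<and>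
        (\<forall>y\<in>W. transition (cell_chart p) (cell_chart q) y i = g y)"
      by (intro exI[of _ W] exI[of _ "\<lambda>y. deck a b k l y i"]) (simp add: elementary_deck)
  qed
  then show ?thesis by (simp add: compatible_def)
qed

lemma smooth_manifold_kodaira: "smooth_manifold kodaira 4 kodaira_atlas"
proof -
  have "topspace kodaira = (\<Union>c\<in>kodaira_atlas. fst c)"
  proof
    show "topspace kodaira \<subseteq> (\<Union>c\<in>kodaira_atlas. fst c)"
      using cell_self by (auto simp: topspace_kodaira kodaira_atlas_def cell_chart_def)
    show "(\<Union>c\<in>kodaira_atlas. fst c) \<subseteq> topspace kodaira"
      using cell_subset by (auto simp: topspace_kodaira kodaira_atlas_def cell_chart_def)
  qed
  then show ?thesis
    by (auto simp: smooth_manifold_def Hausdorff_kodaira second_countable_kodaira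
        kodaira_atlas_def is_chart_cell_chart compatible_cell_chart)
qed

definition deck_jacobian :: "int \<Rightarrow> int \<Rightarrow> nat \<Rightarrow> nat \<Rightarrow> real"
  where "deck_jacobian a b i j =
    (if i = j then 1
     else if i = 2 \<and> j = 0 \<or> i = 3 \<and> j = 1 then a
     else if i = 2 \<and> j = 1 then b
     else if i = 3 \<and> j = 0 then - b
     else 0)"

lemma pderiv_at_deck:
  assumes "i < 4" "j < 4"
  shows "pderiv_at j (\<lambda>x. deck a b k l x i) x = deck_jacobian a b i j"
proof (rule pderiv_at_eqI)
  have "\<forall>i<4. \<forall>j<4. ((\<lambda>t. deck a b k l (x(j := t)) i) has_real_derivative deck_jacobian a b i j) (at (x j))"
    unfolding all_less_4
    by (simp add: deck_def deck_jacobian_def) (auto intro!: derivative_eq_intros)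
  with assms show "((\<lambda>t. deck a b k l (x(j := t)) i) has_real_derivative deck_jacobian a b i j) (at (x j))"
    by blast
qed

lemma jacobian_kodaira_atlas:
  assumes "c \<in> kodaira_atlas" "d \<in> kodaira_atlas" "x \<in> overlap c d"
  shows "\<exists>a b k l. transition c d x = deck a b k l x \<and>
    (\<forall>i<4. \<forall>j<4. jacobian c d x i j = deck_jacobian a b i j)"
proof -
  obtain p q where cd: "c = cell_chart p" "d = cell_chart q"
    using assms by (auto simp: kodaira_atlas_def)
  obtain a b k l W where W: "openin (Euclidean_space 4) W" "x \<in> W"
    "\<forall>y\<in>W. transition c d y = deck a b k l y"
    using transition_locally_deck[OF assms(3)[unfolded cd]] unfolding cd by blast
  have "jacobian c d x i j = deck_jacobian a b i j" if "i < 4" "j < 4" for i j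
    using pderiv_at_cong[OF W(1,2) \<open>j < 4\<close>, of "\<lambda>y. transition c d y i" "\<lambda>y. deck a b k l y i"]
    by (simp add: W(3) jacobian_def pderiv_at_deck[OF that])
  with W show ?thesis by blast
qed


section \<open>The Hermitian metric\<close>

definition dheight :: "(nat \<Rightarrow> real) \<Rightarrow> nat \<Rightarrow> real"
  where "dheight x i = (if i = 0 then - x 0 else if i = 1 then - x 1 else if i = 2 then 1 else 0)"

text \<open>
  The form \<open>d\<^sup>c t = - dt \<circ> J\<close>, which satisfies \<open>d d\<^sup>c t = - 2 dx\<^sub>0 \<and> dx\<^sub>1\<close>.
\<close>

definition dc_height :: "(nat \<Rightarrow> real) \<Rightarrow> nat \<Rightarrow> real"
  where "dc_height x i = (if i = 0 then x 1 else if i = 1 then - x 0 else if i = 3 then 1 else 0)"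

text \<open>
  Any smooth positive, nonconstant function of \<open>t\<close> with period \<open>1\<close> would do; a constant one would give the
  usual Vaisman metric of the Kodaira surface.
\<close>

definition weight :: "(nat \<Rightarrow> real) \<Rightarrow> real"
  where "weight x = 2 + sin (2 * pi * height x)"

text \<open>
  The metric \<open>dx\<^sub>0\<^sup>2 + dx\<^sub>1\<^sup>2 + h(t) (dt\<^sup>2 + (d\<^sup>c t)\<^sup>2)\<close>. Each of its four covectors, as well as \<open>h(t)\<close>,
  is invariant under deck transformations, so that the same formula serves in every chart.
\<close>

definition kodaira_metric :: "(nat \<Rightarrow> real) \<Rightarrow> nat \<Rightarrow> nat \<Rightarrow> real"
  where "kodaira_metric x i j = (if i = j \<and> i < 2 then 1 else 0) +
    weight x * (dheight x i * dheight x j + dc_height x i * dc_height x j)"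

definition lee :: "(nat \<Rightarrow> real) \<Rightarrow> nat \<Rightarrow> real"
  where "lee x i = 2 * weight x * dheight x i"

abbreviation J_field :: "(nat \<Rightarrow> real) tensor2"
  where "J_field \<equiv> \<lambda>_ _. std_complex"

abbreviation metric_field :: "(nat \<Rightarrow> real) tensor2"
  where "metric_field \<equiv> \<lambda>_. kodaira_metric"

abbreviation lee_field :: "(nat \<Rightarrow> real) tensor1"
  where "lee_field \<equiv> \<lambda>_. lee"

lemma weight_pos: "weight x > 0"
  unfolding weight_def using sin_ge_minus_one[of "2 * pi * height x"] by linarith

lemma weight_deck: "weight (deck a b k l x) = weight x"
  by (simp add: weight_def height_deck distrib_left sin_add sin_int_2pin cos_int_2pin)

lemma dheight_deck: "\<forall>i<4. dheight x i = (\<Sum>k<4. dheight (deck a b m l x) k * deck_jacobian a b k i)"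
  unfolding all_less_4 sum_lessThan_4
  by (simp add: dheight_def deck_def deck_jacobian_def)

lemma dc_height_deck: "\<forall>i<4. dc_height x i = (\<Sum>k<4. dc_height (deck a b m l x) k * deck_jacobian a b k i)"
  unfolding all_less_4 sum_lessThan_4
  by (simp add: dc_height_def deck_def deck_jacobian_def)

lemma elementary_weight: "weight \<in> elementary"
  unfolding weight_def by (intro elementary_intros elementary_height)

lemma elementary_dheight: "(\<lambda>x. dheight x i) \<in> elementary"
  unfolding dheight_def by (intro elementary_intros)

lemma elementary_dc_height: "(\<lambda>x. dc_height x i) \<in> elementary"
  unfolding dc_height_def by (intro elementary_intros)

lemma smooth_fun_on_kodaira:
  "f \<in> elementary \<Longrightarrow> c \<in> kodaira_atlas \<Longrightarrow> smooth_fun_on 4 (coord_range c) f"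
  using smooth_fun_on_elementary[OF _ cell_subset]
  by (auto simp: kodaira_atlas_def coord_range_cell_chart)

lemma one_form_lee: "one_form 4 kodaira_atlas lee_field"
  unfolding one_form_def
proof (intro conjI ballI allI impI)
  fix c i assume "c \<in> kodaira_atlas"
  then show "smooth_fun_on 4 (coord_range c) (\<lambda>x. lee x i)"
    unfolding lee_def
    by (intro smooth_fun_on_kodaira elementary_intros elementary_weight elementary_dheight)
next
  fix c d x i assume *: "c \<in> kodaira_atlas" "d \<in> kodaira_atlas" "x \<in> overlap c d" and i: "i < (4::nat)"
  obtain a b k l where t: "transition c d x = deck a b k l x"
    and j: "\<forall>i<4. \<forall>j<4. jacobian c d x i j = deck_jacobian a b i j"
    using jacobian_kodaira_atlas[OF *] by blast
  have "lee x i = 2 * weight x * (\<Sum>m<4. dheight (deck a b k l x) m * deck_jacobian a b m i)"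
    using dheight_deck i by (simp add: lee_def)
  then show "lee x i = (\<Sum>m<4. lee (transition c d x) m * jacobian c d x m i)"
    using i by (simp add: t j lee_def weight_deck sum_distrib_left mult.assoc)
qed

lemma kodaira_metric_deck:
  "\<forall>i<4. \<forall>j<4. kodaira_metric x i j =
    (\<Sum>k<4. \<Sum>m<4. kodaira_metric (deck a b n l x) k m * deck_jacobian a b k i * deck_jacobian a b m j)"
proof (intro allI impI)
  fix i j :: nat assume i: "i < 4" and j: "j < 4"
  let ?y = "deck a b n l x" and ?D = "deck_jacobian a b"
  let ?\<delta> = "\<lambda>k m. if k = m \<and> k < 2 then 1 else 0 :: real"
  have flat: "\<forall>i<4. \<forall>j<4. (\<Sum>k<4. \<Sum>m<4. ?\<delta> k m * ?D k i * ?D m j) = ?\<delta> i j"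
    unfolding all_less_4 sum_lessThan_4 by (simp add: deck_jacobian_def)
  have prod: "(\<Sum>k<4. \<Sum>m<4. \<alpha> k * \<alpha> m * ?D k i * ?D m j) = (\<Sum>k<4. \<alpha> k * ?D k i) * (\<Sum>m<4. \<alpha> m * ?D m j)"
    for \<alpha> :: "nat \<Rightarrow> real"
    by (simp add: sum_product mult_ac)
  have split: "(\<Sum>k<4. \<Sum>m<4. A k m + w * (B k m + C k m)) =
      (\<Sum>k<4. \<Sum>m<4. A k m) + w * ((\<Sum>k<4. \<Sum>m<4. B k m) + (\<Sum>k<4. \<Sum>m<4. C k m))"
    for A B C :: "nat \<Rightarrow> nat \<Rightarrow> real" and w
    by (simp add: sum.distrib sum_distrib_left distrib_left)
  have expand: "kodaira_metric ?y k m * ?D k i * ?D m j = ?\<delta> k m * ?D k i * ?D m j +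
      weight ?y * (dheight ?y k * dheight ?y m * ?D k i * ?D m j + dc_height ?y k * dc_height ?y m * ?D k i * ?D m j)"
    for k m unfolding kodaira_metric_def by (simp only: ring_distribs mult.assoc)
  have "(\<Sum>k<4. \<Sum>m<4. kodaira_metric ?y k m * ?D k i * ?D m j) =
      (\<Sum>k<4. \<Sum>m<4. ?\<delta> k m * ?D k i * ?D m j) +
      weight ?y * ((\<Sum>k<4. \<Sum>m<4. dheight ?y k * dheight ?y m * ?D k i * ?D m j) +
        (\<Sum>k<4. \<Sum>m<4. dc_height ?y k * dc_height ?y m * ?D k i * ?D m j))"
    unfolding expand by (rule split)
  also have "\<dots> = kodaira_metric x i j"
    unfolding prod using i j flat
    by (simp add: kodaira_metric_def weight_deck dheight_deck[rule_format, symmetric] dc_height_deck[rule_format, symmetric])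
  finally show "kodaira_metric x i j = (\<Sum>k<4. \<Sum>m<4. kodaira_metric ?y k m * ?D k i * ?D m j)" ..
qed

lemma bilinear_field_kodaira_metric: "bilinear_field 4 kodaira_atlas metric_field"
  unfolding bilinear_field_def
proof (intro conjI ballI allI impI)
  fix c i j assume "c \<in> kodaira_atlas"
  then show "smooth_fun_on 4 (coord_range c) (\<lambda>x. kodaira_metric x i j)"
    unfolding kodaira_metric_def
    by (intro smooth_fun_on_kodaira elementary_intros elementary_weight elementary_dheight elementary_dc_height)
next
  fix c d x i j assume *: "c \<in> kodaira_atlas" "d \<in> kodaira_atlas" "x \<in> overlap c d"
    and ij: "i < (4::nat)" "j < (4::nat)"
  obtain a b k l where "transition c d x = deck a b k l x"
    and "\<forall>i<4. \<forall>j<4. jacobian c d x i j = deck_jacobian a b i j"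
    using jacobian_kodaira_atlas[OF *] by blast
  with kodaira_metric_deck ij show "kodaira_metric x i j =
    (\<Sum>k<4. \<Sum>l<4. kodaira_metric (transition c d x) k l * jacobian c d x k i * jacobian c d x l j)"
    by simp
qed

lemma kodaira_metric_quadratic_form:
  "(\<Sum>i<4. \<Sum>j<4. kodaira_metric x i j * v i * v j) =
    (v 0)\<^sup>2 + (v 1)\<^sup>2 + weight x * ((v 2 - x 0 * v 0 - x 1 * v 1)\<^sup>2 + (v 3 + x 1 * v 0 - x 0 * v 1)\<^sup>2)"
  unfolding sum_lessThan_4 kodaira_metric_def
  by (simp add: dheight_def dc_height_def) (simp add: algebra_simps power2_eq_square)

lemma kodaira_metric_pos_def:
  assumes "\<exists>i<4. v i \<noteq> 0"
  shows "(\<Sum>i<4. \<Sum>j<4. kodaira_metric x i j * v i * v j) > 0"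
proof (rule ccontr)
  let ?s = "v 2 - x 0 * v 0 - x 1 * v 1" and ?t = "v 3 + x 1 * v 0 - x 0 * v 1"
  assume "\<not> ?thesis"
  then have le: "(v 0)\<^sup>2 + (v 1)\<^sup>2 + weight x * (?s\<^sup>2 + ?t\<^sup>2) \<le> 0"
    by (simp only: kodaira_metric_quadratic_form not_less)
  have w: "0 \<le> weight x * (?s\<^sup>2 + ?t\<^sup>2)"
    using weight_pos[of x] by (simp add: less_imp_le)
  have "(v 0)\<^sup>2 + (v 1)\<^sup>2 \<le> 0"
    using le w by linarith
  then have v01: "v 0 = 0" "v 1 = 0"
    by (simp_all add: sum_power2_le_zero_iff)
  have "weight x * (?s\<^sup>2 + ?t\<^sup>2) = 0"
    using le w zero_le_power2[of "v 0"] zero_le_power2[of "v 1"] by linarith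
  then have "?s = 0 \<and> ?t = 0"
    using weight_pos[of x] by (simp add: sum_power2_eq_zero_iff)
  with v01 have "\<forall>i<4. v i = 0"
    unfolding all_less_4 by simp
  with assms show False by blast
qed

lemma riemannian_kodaira_metric: "riemannian_metric 4 kodaira_atlas metric_field"
  unfolding riemannian_metric_def
  using bilinear_field_kodaira_metric kodaira_metric_pos_def by (simp add: kodaira_metric_def mult.commute)

text \<open>
  The linear part of a deck transformation is complex linear, i.e. all charts of the atlas are
  holomorphic for one and the same complex structure.
\<close>

lemma jacobian_std_complex:
  assumes "c \<in> kodaira_atlas" "d \<in> kodaira_atlas" "x \<in> overlap c d" "i < 4" "j < 4"
  shows "(\<Sum>k<4. jacobian c d x i k * std_complex k j) = (\<Sum>k<4. std_complex i k * jacobian c d x k j)"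
proof -
  obtain a b k l where "transition c d x = deck a b k l x"
    and "\<forall>i<4. \<forall>j<4. jacobian c d x i j = deck_jacobian a b i j"
    using jacobian_kodaira_atlas[OF assms(1-3)] by blast
  moreover have "\<forall>i<4. \<forall>j<4. (\<Sum>k<4. deck_jacobian a b i k * std_complex k j) =
      (\<Sum>k<4. std_complex i k * deck_jacobian a b k j)"
    unfolding all_less_4 sum_lessThan_4 by (simp add: std_complex_def deck_jacobian_def)
  ultimately show ?thesis using assms by simp
qed

lemma almost_complex_J: "almost_complex 4 kodaira_atlas J_field"
proof -
  have "\<forall>i<4. \<forall>j<4. (\<Sum>k<4. std_complex i k * std_complex k j) = (if i = j then - 1 else 0)"
    unfolding all_less_4 sum_lessThan_4 by (simp add: std_complex_def)
  then show ?thesis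
    by (simp add: almost_complex_def endo_field_def jacobian_std_complex smooth_fun_on_kodaira
        elementary.const)
qed

lemma integrable_complex_J: "integrable_complex kodaira 4 kodaira_atlas J_field"
  unfolding integrable_complex_def
proof
  fix p assume "p \<in> topspace kodaira"
  then obtain d where d: "d \<in> kodaira_atlas" "p \<in> fst d"
    using smooth_manifold_kodaira by (auto simp: smooth_manifold_def)
  with smooth_manifold_kodaira show "\<exists>d. is_chart kodaira 4 d \<and> p \<in> fst d \<and> (\<forall>c\<in>kodaira_atlas. compatible 4 c d) \<and>
      (\<forall>c\<in>kodaira_atlas. \<forall>x\<in>overlap c d. \<forall>i<4. \<forall>j<4.
        (\<Sum>k<4. jacobian c d x i k * std_complex k j) = (\<Sum>k<4. std_complex i k * jacobian c d x k j))"
    by (intro exI[of _ d]) (simp add: smooth_manifold_def jacobian_std_complex)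
qed

lemma kodaira_metric_J_invariant:
  "\<forall>i<4. \<forall>j<4. (\<Sum>k<4. \<Sum>l<4. kodaira_metric x k l * std_complex k i * std_complex l j) = kodaira_metric x i j"
  unfolding all_less_4 sum_lessThan_4
  by (simp add: kodaira_metric_def std_complex_def dheight_def dc_height_def)

lemma hermitian_manifold_kodaira: "hermitian_manifold kodaira 2 kodaira_atlas J_field metric_field"
  using smooth_manifold_kodaira almost_complex_J integrable_complex_J riemannian_kodaira_metric kodaira_metric_J_invariant
  by (simp add: hermitian_manifold_def)


section \<open>The Lee vector field\<close>

text \<open>
  The difference \<open>u\<close> of two solutions satisfies \<open>b(u, \<cdot>) = 0\<close>, in particular \<open>b(u, u) = 0\<close>.
\<close>

lemma raise_index_unique:
  assumes pos: "\<And>u. \<exists>i<N. u i \<noteq> 0 \<Longrightarrow> (\<Sum>i<N. \<Sum>j<N. b i j * u i * u j) > (0::real)"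
    and v: "\<forall>i\<ge>N. v i = 0" "\<forall>j<N. (\<Sum>i<N. b i j * v i) = \<alpha> j"
  shows "raise_index N b \<alpha> = v"
  unfolding raise_index_def
proof (rule the_equality)
  show "(\<forall>i\<ge>N. v i = 0) \<and> (\<forall>j<N. (\<Sum>i<N. b i j * v i) = \<alpha> j)"
    using v by blast
next
  fix w assume w: "(\<forall>i\<ge>N. w i = 0) \<and> (\<forall>j<N. (\<Sum>i<N. b i j * w i) = \<alpha> j)"
  define u where "u i = w i - v i" for i
  have "(\<Sum>i<N. b i j * u i) = 0" if "j < N" for j
    using w v(2) that by (simp add: u_def right_diff_distrib sum_subtractf)
  then have "(\<Sum>j<N. (\<Sum>i<N. b i j * u i) * u j) = 0"
    by simp
  also have "(\<Sum>j<N. (\<Sum>i<N. b i j * u i) * u j) = (\<Sum>i<N. \<Sum>j<N. b i j * u i * u j)"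
    unfolding sum_distrib_right by (rule sum.swap)
  finally have "\<forall>i<N. u i = 0"
    using pos[of u] by force
  with w v(1) show "w = v"
    unfolding u_def by (intro ext) (metis eq_iff_diff_eq_0 not_less)
qed

text \<open>
  The vectors \<open>\<partial>\<^sub>0 + x\<^sub>0 \<partial>\<^sub>2 - x\<^sub>1 \<partial>\<^sub>3\<close>, \<open>\<partial>\<^sub>1 + x\<^sub>1 \<partial>\<^sub>2 + x\<^sub>0 \<partial>\<^sub>3\<close>, \<open>\<partial>\<^sub>2\<close> and \<open>\<partial>\<^sub>3\<close> are orthogonal with squared
  lengths \<open>1, 1, h, h\<close>. The solution is read off in this frame; \<open>?p\<close> and \<open>?q\<close> are the values of
  \<open>\<alpha>\<close> on the first two vectors.
\<close>

lemma raise_index_kodaira_metric: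
  assumes "j < 4"
  shows "(\<Sum>i<4. kodaira_metric x i j * raise_index 4 (kodaira_metric x) \<alpha> i) = \<alpha> j"
proof -
  let ?p = "\<alpha> 0 + x 0 * \<alpha> 2 - x 1 * \<alpha> 3" and ?q = "\<alpha> 1 + x 1 * \<alpha> 2 + x 0 * \<alpha> 3"
  define v where "v i = (if i = 0 then ?p else if i = 1 then ?q
    else if i = 2 then x 0 * ?p + x 1 * ?q + \<alpha> 2 / weight x
    else if i = 3 then x 0 * ?q - x 1 * ?p + \<alpha> 3 / weight x else 0)" for i :: nat
  have "\<forall>j<4. (\<Sum>i<4. kodaira_metric x i j * v i) = \<alpha> j"
    unfolding all_less_4 sum_lessThan_4 using weight_pos[of x]
    by (simp add: kodaira_metric_def dheight_def dc_height_def v_def) (simp add: field_simps)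
  moreover have "\<forall>i\<ge>4. v i = 0"
    by (simp add: v_def)
  ultimately show ?thesis
    using raise_index_unique[where b = "kodaira_metric x" and v = v and \<alpha> = \<alpha>, OF kodaira_metric_pos_def] assms
    by simp
qed

text \<open>
  Since \<open>dt(\<partial>\<^sub>2) = 1\<close> and \<open>d\<^sup>c t(\<partial>\<^sub>2) = 0\<close>, one has \<open>g(\<partial>\<^sub>2, \<cdot>) = h(t) dt\<close>. The Lee form carries the
  factor \<open>h\<close> for exactly this reason: its dual is \<open>2 \<partial>\<^sub>2\<close> whatever \<open>h\<close> is, which has constant
  coefficients in holomorphic coordinates.
\<close>

lemma metric_dual_lee: "metric_dual 4 metric_field lee_field c x = (\<lambda>i. if i = 2 then 2 else 0)"
  unfolding metric_dual_def
proof (rule raise_index_unique[OF kodaira_metric_pos_def])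
  show "\<forall>j<4. (\<Sum>i<4. kodaira_metric x i j * (if i = 2 then 2 else 0)) = lee x j"
    unfolding all_less_4 sum_lessThan_4
    by (simp add: kodaira_metric_def lee_def dheight_def dc_height_def)
qed auto

lemma holomorphic_field_lee:
  "holomorphic_field 4 kodaira_atlas J_field (metric_dual 4 metric_field lee_field)"
  by (simp add: holomorphic_field_def lie_deriv_endo_def metric_dual_lee pderiv_at_def)


section \<open>The Lee form\<close>

definition weight_deriv :: "(nat \<Rightarrow> real) \<Rightarrow> real"
  where "weight_deriv x = 2 * pi * cos (2 * pi * height x)"

lemma height_has_pderiv:
  assumes "i < 4"
  shows "((\<lambda>t. height (x(i := t))) has_real_derivative dheight x i) (at (x i))"
proof -
  have "\<forall>i<4. ((\<lambda>t. height (x(i := t))) has_real_derivative dheight x i) (at (x i))"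
    unfolding all_less_4 height_def dheight_def
    by simp (auto intro!: derivative_eq_intros)
  with assms show ?thesis by blast
qed

lemma weight_has_pderiv:
  assumes "i < 4"
  shows "((\<lambda>t. weight (x(i := t))) has_real_derivative weight_deriv x * dheight x i) (at (x i))"
  unfolding weight_def weight_deriv_def
  by (rule derivative_eq_intros height_has_pderiv[OF assms] refl)+ simp

lemma dheight_has_pderiv:
  "((\<lambda>t. dheight (x(i := t)) j) has_real_derivative (if i = j \<and> j < 2 then - 1 else 0)) (at (x i))"
  unfolding dheight_def
  by (cases "j = 0"; cases "j = 1"; cases "i = j") (auto intro!: derivative_eq_intros)

lemma dc_height_has_pderiv:
  "((\<lambda>t. dc_height (x(i := t)) j) has_real_derivative
    (if i = 1 \<and> j = 0 then 1 else if i = 0 \<and> j = 1 then - 1 else 0)) (at (x i))"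
  unfolding dc_height_def
  by (cases "j = 0"; cases "j = 1"; cases "i = j") (auto intro!: derivative_eq_intros)

lemma pderiv_at_lee:
  "i < 4 \<Longrightarrow> pderiv_at i (\<lambda>y. lee y j) x =
    2 * (weight_deriv x * dheight x i * dheight x j + (if i = j \<and> j < 2 then - weight x else 0))"
  unfolding lee_def
  by (rule pderiv_at_eqI) (rule derivative_eq_intros weight_has_pderiv dheight_has_pderiv refl | simp)+

lemma closed_form_lee: "closed_form 4 kodaira_atlas lee_field"
  by (simp add: closed_form_def ext_deriv1_def pderiv_at_lee)

text \<open>
  The fundamental form \<open>dx\<^sub>0 \<and> dx\<^sub>1 + h(t) dt \<and> d\<^sup>c t\<close>.
\<close>

definition kodaira_form :: "(nat \<Rightarrow> real) \<Rightarrow> nat \<Rightarrow> nat \<Rightarrow> real"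
  where "kodaira_form x i j =
    (if i = 0 \<and> j = 1 then 1 else if i = 1 \<and> j = 0 then - 1 else 0) +
    weight x * (dheight x i * dc_height x j - dheight x j * dc_height x i)"

lemma fundamental_form_kodaira:
  assumes "i < 4" "j < 4"
  shows "fundamental_form 4 J_field metric_field c x i j = kodaira_form x i j"
proof -
  have "\<forall>i<4. \<forall>j<4. fundamental_form 4 J_field metric_field c x i j = kodaira_form x i j"
    unfolding all_less_4 fundamental_form_def sum_lessThan_4
    by (simp add: std_complex_def kodaira_metric_def kodaira_form_def dheight_def dc_height_def)
      (simp add: algebra_simps)
  with assms show ?thesis by blast
qed

lemma pderiv_at_kodaira_form:
  assumes "i < 4"
  shows "pderiv_at i (\<lambda>y. kodaira_form y j k) x =
    weight_deriv x * dheight x i * (dheight x j * dc_height x k - dheight x k * dc_height x j) +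
    weight x *
      ((if i = j \<and> j < 2 then - dc_height x k else 0) - (if i = k \<and> k < 2 then - dc_height x j else 0) +
       dheight x j * (if i = 1 \<and> k = 0 then 1 else if i = 0 \<and> k = 1 then - 1 else 0) -
       dheight x k * (if i = 1 \<and> j = 0 then 1 else if i = 0 \<and> j = 1 then - 1 else 0))"
  unfolding kodaira_form_def
  by (rule pderiv_at_eqI)
    (rule derivative_eq_intros weight_has_pderiv[OF assms] dheight_has_pderiv dc_height_has_pderiv refl | simp add: algebra_simps)+

text \<open>
  By \<open>d d\<^sup>c t = - 2 dx\<^sub>0 \<and> dx\<^sub>1\<close> both sides are \<open>2 h(t) dt \<and> dx\<^sub>0 \<and> dx\<^sub>1\<close>; the term with \<open>h'\<close> drops
  out because it contains \<open>dt \<and> dt\<close>.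
\<close>

lemma ext_deriv_kodaira_form:
  assumes "i < 4" "j < 4" "k < 4"
  shows "ext_deriv2 (fundamental_form 4 J_field metric_field) c x i j k =
    wedge12 lee_field (fundamental_form 4 J_field metric_field) c x i j k"
proof -
  have "\<forall>i<4. \<forall>j<4. \<forall>k<4.
      pderiv_at i (\<lambda>y. kodaira_form y j k) x - pderiv_at j (\<lambda>y. kodaira_form y i k) x + pderiv_at k (\<lambda>y. kodaira_form y i j) x =
      lee x i * kodaira_form x j k - lee x j * kodaira_form x i k + lee x k * kodaira_form x i j"
    unfolding all_less_4
    by (simp add: pderiv_at_kodaira_form) (simp add: kodaira_form_def lee_def dheight_def dc_height_def algebra_simps)
  with assms show ?thesis
    by (simp add: ext_deriv2_def wedge12_def fundamental_form_kodaira)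
qed

lemma lee_form_kodaira: "lee_form 2 kodaira_atlas J_field metric_field lee_field"
  using one_form_lee closed_form_lee ext_deriv_kodaira_form by (simp add: lee_form_def)


section \<open>Uniqueness of the Lee form and failure of parallelism\<close>

text \<open>
  A wedge product with a nondegenerate two-form is injective on one-forms in real dimension at least
  four. This is needed because being Vaisman asks for a parallel form among all Lee forms.
\<close>

lemma lee_form_kodaira_unique:
  assumes \<theta>: "lee_form 2 kodaira_atlas J_field metric_field \<theta>"
    and c: "c \<in> kodaira_atlas" and x: "x \<in> coord_range c" and i: "i < 4"
  shows "\<theta> c x i = lee x i"
proof -
  define \<beta> where "\<beta> i = \<theta> c x i - lee x i" for i
  let ?\<omega> = "kodaira_form x" and ?w = "weight x"
  have wedge: "\<beta> i * ?\<omega> j k - \<beta> j * ?\<omega> i k + \<beta> k * ?\<omega> i j = 0" if "i < 4" "j < 4" "k < 4" for i j k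
  proof -
    have "ext_deriv2 (fundamental_form 4 J_field metric_field) c x i j k =
        wedge12 \<theta> (fundamental_form 4 J_field metric_field) c x i j k"
      using \<theta> c x that by (simp add: lee_form_def)
    then have "wedge12 \<theta> (fundamental_form 4 J_field metric_field) c x i j k =
        wedge12 lee_field (fundamental_form 4 J_field metric_field) c x i j k"
      by (simp add: ext_deriv_kodaira_form[OF that])
    then show ?thesis
      using that by (simp add: wedge12_def fundamental_form_kodaira \<beta>_def algebra_simps)
  qed
  have w: "?w \<noteq> 0" using weight_pos[of x] by simp
  have "?w * (\<beta> 0 + x 0 * \<beta> 2 - x 1 * \<beta> 3) = 0" "?w * (\<beta> 1 + x 1 * \<beta> 2 + x 0 * \<beta> 3) = 0"
    using wedge[of 0 2 3] wedge[of 1 2 3]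
    by (simp_all add: kodaira_form_def dheight_def dc_height_def algebra_simps)
  then have b01: "\<beta> 0 = x 1 * \<beta> 3 - x 0 * \<beta> 2" "\<beta> 1 = - x 1 * \<beta> 2 - x 0 * \<beta> 3"
    using w by simp_all
  have "\<beta> 2 = 0" "\<beta> 3 = 0"
    using wedge[of 0 1 2] wedge[of 0 1 3]
    by (simp_all add: b01[simplified] kodaira_form_def dheight_def dc_height_def algebra_simps)
  with b01 have "\<forall>i<4. \<beta> i = 0"
    unfolding all_less_4 by simp
  with i show ?thesis by (simp add: \<beta>_def)
qed

text \<open>
  Because \<open>\<theta>\<^sub>k = 2 g\<^sub>k\<^sub>2\<close>, contracting \<open>\<theta>\<close> with the Christoffel symbols lowers their upper index, and
  the Koszul formula gives \<open>\<theta>(\<nabla>\<^sub>2 \<partial>\<^sub>2) = \<partial>\<^sub>2 g\<^sub>2\<^sub>2 = h'(t)\<close>. On the other hand \<open>\<partial>\<^sub>2 \<theta>\<^sub>2 = 2 h'(t)\<close>.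
\<close>

lemma cov_deriv_lee: "cov_deriv 4 metric_field lee_field c x 2 2 = weight_deriv x"
proof -
  have "kodaira_metric y 2 2 = weight y" for y
    by (simp add: kodaira_metric_def dheight_def dc_height_def)
  moreover have "pderiv_at 2 weight x = weight_deriv x"
    using pderiv_at_eqI[OF weight_has_pderiv[of 2 x]] by (simp add: dheight_def)
  moreover have "lee x k = 2 * kodaira_metric x k 2" for k
    by (simp add: lee_def kodaira_metric_def dheight_def dc_height_def)
  then have "(\<Sum>k<4. christoffel 4 metric_field c x 2 2 k * lee x k) =
      2 * (\<Sum>k<4. kodaira_metric x k 2 * christoffel 4 metric_field c x 2 2 k)"
    by (simp add: sum_distrib_left mult_ac)
  then have "(\<Sum>k<4. christoffel 4 metric_field c x 2 2 k * lee x k) =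
      pderiv_at 2 (\<lambda>y. kodaira_metric y 2 2) x"
    unfolding christoffel_def by (simp add: raise_index_kodaira_metric)
  ultimately show ?thesis
    by (simp add: cov_deriv_def pderiv_at_lee dheight_def)
qed

text \<open>
  At the origin \<open>h'(0) = 2 \<pi>\<close>.
\<close>

lemma not_vaisman_kodaira: "\<not> vaisman_manifold kodaira 2 kodaira_atlas J_field metric_field"
proof
  let ?o = "\<lambda>_. 0 :: real"
  let ?c = "cell_chart ?o"
  assume "vaisman_manifold kodaira 2 kodaira_atlas J_field metric_field"
  then obtain \<theta> where \<theta>: "lee_form 2 kodaira_atlas J_field metric_field \<theta>"
    and par: "parallel_form 4 kodaira_atlas metric_field \<theta>"
    by (auto simp: vaisman_manifold_def)
  have o: "?o \<in> E4" by (simp add: topspace_Euclidean_space)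
  then have c: "?c \<in> kodaira_atlas" by (simp add: kodaira_atlas_def)
  \<comment> \<open>\<open>\<theta>\<close> is known only inside the cell, but the derivative at an interior point is determined by that\<close>
  note eq = lee_form_kodaira_unique[OF \<theta> c, unfolded coord_range_cell_chart]
  have "pderiv_at 2 (\<lambda>y. \<theta> ?c y 2) ?o = pderiv_at 2 (\<lambda>y. lee y 2) ?o"
    by (rule pderiv_at_cong[OF openin_cell cell_self[OF o]]) (simp_all add: eq)
  then have "cov_deriv 4 metric_field \<theta> ?c ?o 2 2 = cov_deriv 4 metric_field lee_field ?c ?o 2 2"
    by (simp add: cov_deriv_def eq cell_self[OF o])
  also have "\<dots> \<noteq> 0"
    by (simp add: cov_deriv_lee weight_deriv_def height_def)
  finally show False
    using par c o by (simp add: parallel_form_def coord_range_cell_chart cell_self)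
qed

theorem mainTheorem2:
  shows "\<exists>n (X :: (nat \<Rightarrow> real) topology) A J g.
    n \<ge> 2 \<and> compact_space X \<and> lck_manifold X n A J g \<and>
    (\<exists>\<theta>. lee_form n A J g \<theta> \<and> holomorphic_field (2 * n) A J (metric_dual (2 * n) g \<theta>)) \<and>
    \<not> vaisman_manifold X n A J g"
proof -
  have "holomorphic_field (2 * 2) kodaira_atlas J_field (metric_dual (2 * 2) metric_field lee_field)"
    using holomorphic_field_lee by simp
  then show ?thesis
    using compact_kodaira hermitian_manifold_kodaira lee_form_kodaira not_vaisman_kodaira
    unfolding lck_manifold_def
    by (intro exI[of _ 2] exI[of _ kodaira] exI[of _ kodaira_atlas] exI[of _ J_field] exI[of _ metric_field]) blast
qed

end
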